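(* Let $D=\{(x,y)\in\mathbb Z_{>0}^2 : x>y\}$, and consider lines $l:y=kx+b$ with $k,b\in\mathbb Q$ and $l\cap D\neq\emptyset$. (1) If $k\in\mathbb Q$ and $k\ge -\dfrac{\ln\frac{3(2+\sqrt2)}{4}}{\ln\frac{2(2+\sqrt2)}{3}}\ (\approx -1.1432)$, then the generalized Markov numbers increase with $x$ along every line $l:y=kx+b$. (2) If $k\in\mathbb Q$ and $k\le -\dfrac{2\ln\left(\frac{1+\sqrt5}{2}\right)}{\ln\left(\frac{3(1+\sqrt5)}{2\sqrt5}\right)}\ (\approx -1.2417)$, then the generalized Markov numbers decrease with $x$ along every line $l:y=kx+b$. (3) If $k\in\mathbb Q$ and $-\dfrac{2\ln\left(\frac{1+\sqrt5}{2}\right)}{\ln\left(\frac{3(1+\sqrt5)}{2\sqrt5}\right)}<k<-\dfrac{\ln\frac{3(2+\sqrt2)}{4}}{\ln\frac{2(2+\sqrt2)}{3}}$, then for all but finitely many $b\in\mathbb Q$ such that the line $y=kx+b$ meets $D$, the generalized Markov numbers are not monotonic along the line $y=kx+b$ (that is, they neither increase nor decrease with $x$ along it). (4) Along any line $l$ along which the generalized Markov numbers are not monotonic, as the $x$-coordinate increases the generalized Markov numbers first decrease and then increase. (5) Let $l$ have slope $k<0$ and contain at least two points of $D$. Then the generalized Markov numbers are not monotonic along $l$ if and only if $r_l(u_l,v_l)<1$ and $r_l(z_l,w_l)>1$.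
   Context: Generalized Markov numbers. For $A=(x,y)\in\mathbb Z_{\ge0}^2$ with $y\le x$, $m_{x,y}=|OA|$ is the Markov distance from $O=(0,0)$ to $A$: the positive integer obtained from the element of the once-punctured torus cluster algebra attached to the left deformation of the segment $OA$ by specializing the three initial cluster variables to $1$. Concretely, for coprime $(x,y)$ the number $m_{x,y}$ is the Markov number attached to the Farey fraction $y/x$: $m_{1,0}=m_{0,1}=1$, $m_{1,1}=2$, and whenever $(a,b),(c,d)\in\mathbb Z_{\ge0}^2$ satisfy $|ad-bc|=1$ and $\{(a,b),(c,d)\}\ne\{(1,0),(0,1)\}$, $m_{a+c,b+d}=3m_{a,b}m_{c,d}-m_{|a-c|,|b-d|}$ (e.g. $m_{2,1}=5$, $m_{3,1}=13$, $m_{3,2}=29$). For non-coprime points: if $q,p$ are coprime and $f_n=m_{nq,np}$, then $f_0=0$, $f_1=m_{q,p}$, $f_n=3f_1f_{n-1}-f_{n-2}$ for $n\ge2$. For $(x,y)\in D$ the number $m_{x,y}$ is called a generalized Markov number. Lines. For a line $l:y=kx+b$ with $k,b\in\mathbb Q$, list the points of $D\cap l$ as $(x_1,y_1),(x_2,y_2),\dots$ with $x_1<x_2<\cdots$. The ratio along $l$ at $(x_i,y_i)$ (when $(x_{i+1},y_{i+1})$ exists) is $r_l(x_i,y_i)=m_{x_{i+1},y_{i+1}}/m_{x_i,y_i}$. The generalized Markov numbers increase (resp. decrease) with $x$ along $l$ if $r_l(x_i,y_i)\ge1$ (resp. $\le1$) for all $i$; they are monotonic along $l$ if they increase or decrease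 along $l$. "First decrease and then increase" means that there is an index $i_0$ such that $m_{x_i,y_i}\ge m_{x_{i+1},y_{i+1}}$ for $i<i_0$ and $m_{x_i,y_i}\le m_{x_{i+1},y_{i+1}}$ for $i\ge i_0$. $(u_l,v_l),(u'_l,v'_l)$ denote the first two points of $D\cap l$; if $k<0$, $(z_l,w_l),(z'_l,w'_l)$ denote the last two points of $D\cap l$ (so $(z_l,w_l)$ is the next-to-last point). *)

theory Defs
  imports Complex_Main "HOL-Library.Infinite_Set"
begin

section \<open>Generalized Markov numbers\<close>

text \<open>\<open>markov_val x y u\<close> says that the coprime pair \<open>(x, y)\<close> carries the Markov number \<open>u\<close>,
  i.e. that \<open>u\<close> is the Markov number attached to the Farey fraction \<open>y / x\<close>. That every coprime
  pair carries exactly one value is \<open>markov_val_ex1\<close> below.\<close>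

inductive markov_val :: "nat \<Rightarrow> nat \<Rightarrow> int \<Rightarrow> bool" where
  e1: "markov_val 1 0 1"
| e2: "markov_val 0 1 1"
| diag: "markov_val 1 1 2"
| farey: "markov_val (a + c) (b + d) (3 * u * v - w)"
  if "markov_val a b u" "markov_val c d v"
     "markov_val (nat \<bar>int a - int c\<bar>) (nat \<bar>int b - int d\<bar>) w"
     "\<bar>int a * int d - int b * int c\<bar> = 1"
     "{(a, b), (c, d)} \<noteq> {(1, 0), (0, 1)}"

definition markov_number :: "nat \<Rightarrow> nat \<Rightarrow> int" where
  "markov_number x y = (THE u. markov_val x y u)"

text \<open>The sequence \<open>f\<close> of values at the multiples of a coprime pair with \<open>f 1 = u\<close>.\<close>

fun markov_mult :: "int \<Rightarrow> nat \<Rightarrow> int" where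
  "markov_mult u 0 = 0"
| "markov_mult u (Suc 0) = u"
| "markov_mult u (Suc (Suc n)) = 3 * u * markov_mult u (Suc n) - markov_mult u n"

definition gen_markov :: "nat \<Rightarrow> nat \<Rightarrow> int" where
  "gen_markov x y =
     markov_mult (markov_number (x div gcd x y) (y div gcd x y)) (gcd x y)"


subsection \<open>Well-definedness\<close>

lemma det_coprime:
  fixes a b c d :: nat
  assumes "\<bar>int a * int d - int b * int c\<bar> = 1"
  shows "coprime a b" and "coprime c d"
    and "coprime (nat \<bar>int a - int c\<bar>) (nat \<bar>int b - int d\<bar>)"
proof -
  have *: "coprime p q" if "\<bar>p * s - q * r\<bar> = 1" for p q r s :: int
  proof (rule coprimeI)
    fix e assume "e dvd p" "e dvd q"
    then have "e dvd \<bar>p * s - q * r\<bar>" by simp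
    then show "is_unit e" using that by simp
  qed
  show "coprime a b" using *[OF assms] by simp
  have "\<bar>int c * int b - int d * int a\<bar> = 1" using assms by (simp add: mult.commute abs_minus_commute)
  from *[OF this] show "coprime c d" by simp
  have "(int a - int c) * int d - (int b - int d) * int c = int a * int d - int b * int c"
    by (simp add: algebra_simps)
  then have "\<bar>(int a - int c) * int d - (int b - int d) * int c\<bar> = 1" using assms by simp
  from *[OF this] have "coprime \<bar>int a - int c\<bar> \<bar>int b - int d\<bar>" by simp
  then show "coprime (nat \<bar>int a - int c\<bar>) (nat \<bar>int b - int d\<bar>)"
    by (simp flip: coprime_int_iff)
qed

lemma det_decompose_unique_aux:
  fixes a b c d a' b' c' d' :: nat
  assumes s: "a + c = a' + c'" "b + d = b' + d'"
    and 1: "int a * int d - int b * int c = 1" and 2: "int a' * int d' - int b' * int c' = 1"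
  shows "a = a' \<and> b = b' \<and> c = c' \<and> d = d'"
proof -
  define x y where "x = int a + int c" and "y = int b + int d"
  have x': "x = int a' + int c'" and y': "y = int b' + int d'" using s x_def y_def by linarith+
  have A: "int a * y - int b * x = 1" using 1 unfolding x_def y_def by (simp add: algebra_simps)
  have A': "int a' * y - int b' * x = 1" using 2 unfolding x' y' by (simp add: algebra_simps)
  have e: "(int a - int a') * y = (int b - int b') * x" using A A' by (simp add: algebra_simps)
  have cop: "coprime x y"
  proof (rule coprimeI)
    fix e assume "e dvd x" "e dvd y"
    then have "e dvd int a * y - int b * x" by simp
    then show "is_unit e" using A by simp
  qed
  have nonneg: "0 \<le> int b * int c" "0 \<le> int b' * int c'" by simp_all
  have a: "a \<noteq> 0" "a' \<noteq> 0" by (rule notI, use 1 2 nonneg in simp)+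
  have "x dvd (int a - int a') * y" using e by simp
  then have "x dvd int a - int a'" using cop coprime_dvd_mult_left_iff by blast
  moreover have "\<bar>int a - int a'\<bar> < x" using a x_def x' by linarith
  ultimately have "int a - int a' = 0" using zdvd_imp_le[of x "\<bar>int a - int a'\<bar>"] by auto
  then have aa: "a = a'" by simp
  moreover have "x \<noteq> 0" using a x_def by linarith
  ultimately have "b = b'" using e by simp
  then show ?thesis using aa s by simp
qed

lemma det_decompose_unique:
  fixes a b c d a' b' c' d' :: nat
  assumes s: "a + c = a' + c'" "b + d = b' + d'"
    and 1: "\<bar>int a * int d - int b * int c\<bar> = 1" and 2: "\<bar>int a' * int d' - int b' * int c'\<bar> = 1"
  shows "(a = a' \<and> b = b' \<and> c = c' \<and> d = d') \<or> (a = c' \<and> b = d' \<and> c = a' \<and> d = b')"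
proof -
  have sw: "int p * int s - int q * int r = - 1 \<Longrightarrow> int r * int q - int s * int p = 1" for p q r s :: nat
    by (simp add: algebra_simps)
  have "int a * int d - int b * int c = 1 \<or> int c * int b - int d * int a = 1"
    using 1 sw[of a d b c] by linarith
  moreover have "int a' * int d' - int b' * int c' = 1 \<or> int c' * int b' - int d' * int a' = 1"
    using 2 sw[of a' d' b' c'] by linarith
  moreover have "c + a = c' + a'" "d + b = d' + b'" "a + c = c' + a'" "b + d = d' + b'"
    "c + a = a' + c'" "d + b = b' + d'" using s by simp_all
  ultimately show ?thesis
    using det_decompose_unique_aux[of a c a' c' b d b' d', OF s]
      det_decompose_unique_aux[of c a c' a' d b d' b']
      det_decompose_unique_aux[of a c c' a' b d d' b'] det_decompose_unique_aux[of c a a' c' d b b' d']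
    by blast
qed

lemma det_sum_not_base:
  fixes a b c d :: nat
  assumes "\<bar>int a * int d - int b * int c\<bar> = 1" "{(a, b), (c, d)} \<noteq> {(1, 0), (0, 1)}"
  shows "\<not> (a + c = 1 \<and> b + d = 0)" "\<not> (a + c = 0 \<and> b + d = 1)" "\<not> (a + c = 1 \<and> b + d = 1)"
proof -
  show "\<not> (a + c = 1 \<and> b + d = 0)" "\<not> (a + c = 0 \<and> b + d = 1)"
    by (rule notI, use assms(1) in simp)+
  show "\<not> (a + c = 1 \<and> b + d = 1)"
  proof
    assume "a + c = 1 \<and> b + d = 1"
    then have "(a = 0 \<and> c = 1 \<or> a = 1 \<and> c = 0) \<and> (b = 0 \<and> d = 1 \<or> b = 1 \<and> d = 0)" by linarith
    with assms show False by auto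
  qed
qed

lemma markov_val_base_inv:
  assumes "markov_val x y u"
  shows "x = 1 \<and> y = 0 \<Longrightarrow> u = 1" and "x = 0 \<and> y = 1 \<Longrightarrow> u = 1" and "x = 1 \<and> y = 1 \<Longrightarrow> u = 2"
proof -
  from assms have "(x = 1 \<and> y = 0 \<longrightarrow> u = 1) \<and> (x = 0 \<and> y = 1 \<longrightarrow> u = 1) \<and> (x = 1 \<and> y = 1 \<longrightarrow> u = 2)"
  proof cases
    case (farey a b u c d v w)
    from det_sum_not_base[OF farey(7,8), folded farey(1,2)] show ?thesis by blast
  qed simp_all
  then show "x = 1 \<and> y = 0 \<Longrightarrow> u = 1" "x = 0 \<and> y = 1 \<Longrightarrow> u = 1" "x = 1 \<and> y = 1 \<Longrightarrow> u = 2"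
    by blast+
qed

lemma markov_val_farey_inv:
  assumes "markov_val x y u" "x = a + c" "y = b + d" "\<bar>int a * int d - int b * int c\<bar> = 1"
    "{(a, b), (c, d)} \<noteq> {(1, 0), (0, 1)}"
  obtains u1 v1 w1 where "markov_val a b u1" "markov_val c d v1"
    "markov_val (nat \<bar>int a - int c\<bar>) (nat \<bar>int b - int d\<bar>) w1" "u = 3 * u1 * v1 - w1"
proof -
  note nb = det_sum_not_base[OF assms(4,5)]
  from assms(1) show thesis
  proof cases
    case (farey a' b' u' c' d' v' w')
    have s: "a + c = a' + c'" "b + d = b' + d'" using assms(2,3) farey(1,2) by simp_all
    from det_decompose_unique[OF s assms(4) farey(7)] show thesis
    proof
      assume "a = a' \<and> b = b' \<and> c = c' \<and> d = d'"
      then show thesis using farey that[of u' v' w'] by simp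
    next
      assume "a = c' \<and> b = d' \<and> c = a' \<and> d = b'"
      then show thesis using farey that[of v' u' w'] by (simp add: abs_minus_commute mult.commute)
    qed
  qed (use nb assms(2,3) in simp_all)
qed

lemma markov_val_unique: "markov_val x y u \<Longrightarrow> markov_val x y u' \<Longrightarrow> u = u'"
proof (induction arbitrary: u' rule: markov_val.induct)
  case e1
  then show ?case using markov_val_base_inv(1)[of 1 0 u'] by simp
next
  case e2
  then show ?case using markov_val_base_inv(2)[of 0 1 u'] by simp
next
  case diag
  then show ?case using markov_val_base_inv(3)[of 1 1 u'] by simp
next
  case (farey a b u c d v w)
  obtain u1 v1 w1 where "markov_val a b u1" "markov_val c d v1"
    "markov_val (nat \<bar>int a - int c\<bar>) (nat \<bar>int b - int d\<bar>) w1" "u' = 3 * u1 * v1 - w1"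
    using markov_val_farey_inv[OF farey.prems refl refl farey.hyps(4,5)] .
  then show ?case using farey.IH by simp
qed

lemma det_decompose_exists:
  fixes x y :: nat
  assumes "coprime x y" "x \<noteq> 0" "y \<noteq> 0"
  obtains a b c d :: nat where "x = a + c" "y = b + d" "\<bar>int a * int d - int b * int c\<bar> = 1"
proof -
  obtain s t where st: "s * int x + t * int y = 1"
    using bezout_int[of "int x" "int y"] assms(1) by (auto simp: coprime_int_iff)
  define a where "a = (t - 1) mod int x + 1"
  have x: "0 < int x" and y: "0 < int y" using assms(2,3) by simp_all
  have a: "1 \<le> a" "a \<le> int x" unfolding a_def
    using pos_mod_sign[OF x, of "t - 1"] pos_mod_bound[OF x, of "t - 1"] by linarith+
  have "a - t = int x * - ((t - 1) div int x)"
    unfolding a_def using minus_div_mult_eq_mod[of "t - 1" "int x"] by (simp add: algebra_simps)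
  then have "(a - t) * int y = int x * - ((t - 1) div int x) * int y" by simp
  then have "a * int y - 1 = int x * (- ((t - 1) div int x) * int y - s)"
    using st by (simp add: algebra_simps)
  then obtain b where b: "a * int y - 1 = int x * b" by blast
  have "1 * 1 \<le> a * int y" using a y by (intro mult_mono) simp_all
  then have "0 \<le> int x * b" using b by linarith
  then have b0: "0 \<le> b" using assms(2) by (simp add: zero_le_mult_iff)
  have "int x * b < int x * int y" using b a mult_right_mono[OF a(2), of "int y"] by linarith
  then have b1: "b < int y" using assms(2) by simp
  show thesis
  proof (rule that[of "nat a" "nat (int x - a)" "nat b" "nat (int y - b)"])
    show "x = nat a + nat (int x - a)" "y = nat b + nat (int y - b)" using a b0 b1 by linarith+
    have "a * (int y - b) - b * (int x - a) = 1" using b by (simp add: algebra_simps)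
    then show "\<bar>int (nat a) * int (nat (int y - b)) - int (nat b) * int (nat (int x - a))\<bar> = 1"
      using a b0 b1 by simp
  qed
qed

lemma markov_val_exists: "coprime x y \<Longrightarrow> \<exists>u. markov_val x y u"
proof (induction "x + y" arbitrary: x y rule: less_induct)
  case less
  consider "x = 0" | "y = 0" | "x = 1" "y = 1" | "x \<noteq> 0" "y \<noteq> 0" "\<not> (x = 1 \<and> y = 1)" by blast
  then show ?case
  proof cases
    case 1 then show ?thesis using less.prems markov_val.e2 by auto
  next
    case 2 then show ?thesis using less.prems markov_val.e1 by auto
  next
    case 3 then show ?thesis using markov_val.diag by auto
  next
    case 4
    obtain a b c d :: nat where s: "x = a + c" "y = b + d" and
      det: "\<bar>int a * int d - int b * int c\<bar> = 1"
      using det_decompose_exists[OF less.prems 4(1,2)] .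
    have ne: "{(a, b), (c, d)} \<noteq> {(1, 0), (0, 1)}" using 4 s by (auto simp: doubleton_eq_iff)
    have nz: "\<not> (a = 0 \<and> b = 0)" "\<not> (c = 0 \<and> d = 0)"
      by (rule notI, use det in simp)+
    have "\<not> (min a c = 0 \<and> min b d = 0)"
    proof
      assume "min a c = 0 \<and> min b d = 0"
      then have "(a = 0 \<or> c = 0) \<and> (b = 0 \<or> d = 0)" by (auto simp: min_def split: if_splits)
      with det nz have "a = 0 \<and> d = 0 \<and> b * c = 1 \<or> c = 0 \<and> b = 0 \<and> a * d = 1"
        by (auto simp flip: of_nat_mult)
      then show False using ne by auto
    qed
    then have lt: "nat \<bar>int a - int c\<bar> + nat \<bar>int b - int d\<bar> < x + y" using s by linarith
    have lts: "a + b < x + y" "c + d < x + y" using s nz by linarith+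
    obtain u v w where "markov_val a b u" "markov_val c d v"
      "markov_val (nat \<bar>int a - int c\<bar>) (nat \<bar>int b - int d\<bar>) w"
      using less.hyps[OF lts(1) det_coprime(1)[OF det]] less.hyps[OF lts(2) det_coprime(2)[OF det]]
        less.hyps[OF lt det_coprime(3)[OF det]] by blast
    from markov_val.farey[OF this det ne] show ?thesis using s by auto
  qed
qed

lemma markov_val_ex1: "coprime x y \<Longrightarrow> \<exists>!u. markov_val x y u"
  using markov_val_exists markov_val_unique by blast

lemma markov_val_markov_number: "coprime x y \<Longrightarrow> markov_val x y (markov_number x y)"
  unfolding markov_number_def using theI'[OF markov_val_ex1] .

lemma markov_number_eqI: "markov_val x y u \<Longrightarrow> markov_number x y = u"
  unfolding markov_number_def using markov_val_unique by blast

lemma gen_markov_coprime: "coprime x y \<Longrightarrow> gen_markov x y = markov_number x y"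
  by (simp add: gen_markov_def)

lemma gen_markov_base: "gen_markov 1 0 = 1" "gen_markov 0 1 = 1" "gen_markov 1 1 = 2"
  by (simp_all add: gen_markov_coprime markov_number_eqI[OF markov_val.e1[simplified]]
      markov_number_eqI[OF markov_val.e2[simplified]] markov_number_eqI[OF markov_val.diag[simplified]])

lemma gen_markov_farey:
  assumes "\<bar>int a * int d - int b * int c\<bar> = 1" "{(a, b), (c, d)} \<noteq> {(1, 0), (0, 1)}"
  shows "gen_markov (a + c) (b + d) =
    3 * gen_markov a b * gen_markov c d
      - gen_markov (nat \<bar>int a - int c\<bar>) (nat \<bar>int b - int d\<bar>)"
proof -
  note cop = det_coprime[OF assms(1)]
  have "\<bar>int (a + c) * int d - int (b + d) * int c\<bar> = 1" using assms(1) by (simp add: algebra_simps)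
  from det_coprime(1)[OF this] have "coprime (a + c) (b + d)" .
  with markov_number_eqI[OF markov_val.farey[OF cop[THEN markov_val_markov_number] assms]] cop
  show ?thesis by (simp add: gen_markov_coprime)
qed

lemma gen_markov_multiple:
  assumes "coprime q p"
  shows "gen_markov (n * q) (n * p) = markov_mult (gen_markov q p) n"
proof (cases "n = 0")
  case False
  have "gcd (n * q) (n * p) = n" using assms by (simp add: gcd_mult_distrib_nat[symmetric])
  then show ?thesis using False assms by (simp add: gen_markov_coprime) (simp add: gen_markov_def)
qed (simp add: gen_markov_def)


section \<open>Monotonicity along lines\<close>

definition D :: "(nat \<times> nat) set" where
  "D = {(x, y). 0 < y \<and> y < x}"

text \<open>The points of \<open>D\<close> on the line \<open>y = k x + b\<close>.\<close>

definition line_pts :: "real \<Rightarrow> real \<Rightarrow> (nat \<times> nat) set" where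
  "line_pts k b = {(x, y) \<in> D. real y = k * real x + b}"

text \<open>The points of \<open>D\<close> on a line are listed by increasing \<open>x\<close>, starting with index \<open>0\<close>; the list
  may be finite or infinite. \<open>enumerate\<close> is meaningless beyond the end of a finite set, so
  every use of \<open>pt_x\<close>, \<open>pt_y\<close> and \<open>ratio\<close> is guarded by \<open>has_pt\<close>.\<close>

definition has_pt :: "real \<Rightarrow> real \<Rightarrow> nat \<Rightarrow> bool" where
  "has_pt k b i \<longleftrightarrow> infinite (line_pts k b) \<or> i < card (line_pts k b)"

definition pt_x :: "real \<Rightarrow> real \<Rightarrow> nat \<Rightarrow> nat" where
  "pt_x k b i = enumerate (fst ` line_pts k b) i"

definition pt_y :: "real \<Rightarrow> real \<Rightarrow> nat \<Rightarrow> nat" where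
  "pt_y k b i = (THE y. (pt_x k b i, y) \<in> line_pts k b)"

definition markov_at :: "real \<Rightarrow> real \<Rightarrow> nat \<Rightarrow> int" where
  "markov_at k b i = gen_markov (pt_x k b i) (pt_y k b i)"

definition ratio :: "real \<Rightarrow> real \<Rightarrow> nat \<Rightarrow> real" where
  "ratio k b i = real_of_int (markov_at k b (Suc i)) / real_of_int (markov_at k b i)"

definition markov_increasing :: "real \<Rightarrow> real \<Rightarrow> bool" where
  "markov_increasing k b \<longleftrightarrow> (\<forall>i. has_pt k b (Suc i) \<longrightarrow> ratio k b i \<ge> 1)"

definition markov_decreasing :: "real \<Rightarrow> real \<Rightarrow> bool" where
  "markov_decreasing k b \<longleftrightarrow> (\<forall>i. has_pt k b (Suc i) \<longrightarrow> ratio k b i \<le> 1)"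

definition markov_monotonic :: "real \<Rightarrow> real \<Rightarrow> bool" where
  "markov_monotonic k b \<longleftrightarrow> markov_increasing k b \<or> markov_decreasing k b"

definition first_decrease_then_increase :: "real \<Rightarrow> real \<Rightarrow> bool" where
  "first_decrease_then_increase k b \<longleftrightarrow>
     (\<exists>i0. has_pt k b i0 \<and>
        (\<forall>i<i0. markov_at k b i \<ge> markov_at k b (Suc i)) \<and>
        (\<forall>i\<ge>i0. has_pt k b (Suc i) \<longrightarrow> markov_at k b i \<le> markov_at k b (Suc i)))"

text \<open>The ratios at the first and at the next-to-last point of \<open>D\<close> on the line. The former needs at
  least two points on the line; the latter also needs finitely many, which is the case
  when \<open>k < 0\<close>.\<close>

definition first_ratio :: "real \<Rightarrow> real \<Rightarrow> real" where
  "first_ratio k b = ratio k b 0"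

definition last_ratio :: "real \<Rightarrow> real \<Rightarrow> real" where
  "last_ratio k b = ratio k b (card (line_pts k b) - 2)"

end

theory Submission
  imports Defs
begin

text \<open>Three times the Markov number of a primitive vector is a trace \<open>2 cosh L\<close>, and \<open>L\<close> extends
  to a norm that is convex but has a corner in every rational direction: for primitive \<open>P\<close>, the
  slopes of the norm on the two sides of \<open>P\<close> differ by \<open>2 ln (coth L(P))\<close> times the determinant
  with \<open>P\<close>. Since \<open>ln (3 m(nP)) < n L(P) + ln (coth L(P))\<close> and \<open>ln (3 m)\<close> dominates the norm, the
  corner exactly absorbs the excess of \<open>ln (3 m)\<close> at imprimitive points. Hence
  \<open>m(A)\<^sup>2 \<le> m(A + v) m(A - v)\<close>, so the ratios along a line of negative slope increase.

  The linear functionals supporting the norm at \<open>(1, 0)\<close> and, from below the diagonal, at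
  \<open>(1, 1)\<close> bound all functionals supporting it inside the cone; the two critical slopes are the
  slopes of their kernels. For a slope strictly between these, upper bounds for \<open>m\<close> show that near
  the two boundary rays \<open>m\<close> is asymptotic to the exponential of the respective functional.\<close>

section \<open>The Markov equation on Farey pairs\<close>

text \<open>The norm is never constructed: only its values \<open>len\<close> at primitive vectors
  occur, and convexity enters as \<open>support_ineq\<close>, which bounds these values from below
  by a one-sided slope. The size of the corner comes from the Markov equation. Along (c,d) + j (a,b)
  the traces combine e^(jL) and e^(-jL), and the Markov equation says that the two coefficients have
  product coth^2 L. Running through the sequence backwards, towards the neighbour on the other side
  of (a,b), exchanges the coefficients. So both one-sided slopes at (a,b) are logarithms of these
  coefficients up to multiples of L, and their gap is 2 ln coth L. Convexity then reduces to two
  facts, that this gap is positive and that ln lead is at most the length of the neighbour; a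
  Euclidean descent on determinants does the rest.\<close>

definition mtrace :: "int \<Rightarrow> int \<Rightarrow> real" where
  "mtrace x y = 3 * real_of_int (gen_markov (nat x) (nat y))"

section \<open>Quadrant vectors of determinant one and their descent to the standard basis\<close>

definition farey_pair :: "int \<Rightarrow> int \<Rightarrow> int \<Rightarrow> int \<Rightarrow> bool" where
  "farey_pair a b c d \<longleftrightarrow> 0 \<le> a \<and> 0 \<le> b \<and> 0 \<le> c \<and> 0 \<le> d \<and> \<bar>a * d - b * c\<bar> = 1"

lemma farey_pair_nonneg: "farey_pair a b c d \<Longrightarrow> 0 \<le> a" "farey_pair a b c d \<Longrightarrow> 0 \<le> b" "farey_pair a b c d \<Longrightarrow> 0 \<le> c" "farey_pair a b c d \<Longrightarrow> 0 \<le> d"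
  by (simp_all add: farey_pair_def)

lemma farey_pair_commute: "farey_pair a b c d \<Longrightarrow> farey_pair c d a b"
  by (simp add: farey_pair_def mult.commute abs_minus_commute)

lemma farey_pair_add: "farey_pair a b c d \<Longrightarrow> farey_pair a b (a + c) (b + d)"
  by (simp add: farey_pair_def algebra_simps)

lemma farey_pair_add_mult: "farey_pair a b c d \<Longrightarrow> farey_pair a b (c + int j * a) (d + int j * b)"
  by (simp add: farey_pair_def algebra_simps)

lemma det_one_coprime:
  fixes a b c d :: int
  assumes "\<bar>a * d - b * c\<bar> = 1"
  shows "coprime a b" "coprime c d"
proof -
  have *: "coprime p q" if "\<bar>p * s - q * r\<bar> = 1" for p q r s :: int
  proof (rule coprimeI)
    fix e assume "e dvd p" "e dvd q"
    then have "e dvd \<bar>p * s - q * r\<bar>" by simp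
    then show "is_unit e" using that by simp
  qed
  show "coprime a b" using *[OF assms] .
  show "coprime c d" using *[of c b d a] assms by (simp add: mult.commute abs_minus_commute)
qed

lemma farey_pair_coprime: "farey_pair a b c d \<Longrightarrow> coprime a b" "farey_pair a b c d \<Longrightarrow> coprime c d"
  using det_one_coprime[of a d b c] by (simp_all add: farey_pair_def)

lemma farey_pair_sum_pos:
  assumes "farey_pair a b c d" shows "1 \<le> a + b" "1 \<le> c + d"
proof -
  have "\<not> (a = 0 \<and> b = 0)" "\<not> (c = 0 \<and> d = 0)" using assms by (auto simp: farey_pair_def)
  then show "1 \<le> a + b" "1 \<le> c + d" using assms unfolding farey_pair_def by linarith+
qed

lemma farey_pair_comparable_aux:
  fixes a b c d :: int
  assumes "0 \<le> b" "0 \<le> c" "c < a" "b < d" "\<bar>a * d - b * c\<bar> = 1"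
  shows "a = 1 \<and> b = 0 \<and> c = 0 \<and> d = 1"
proof -
  have "(c + 1) * (b + 1) \<le> a * d" using assms by (intro mult_mono) auto
  then have "b * c + b + c + 1 \<le> a * d" by (simp add: algebra_simps)
  with assms have "b = 0 \<and> c = 0" by linarith
  moreover have "0 < a * d" using assms by (intro mult_pos_pos) auto
  ultimately have "a * d = 1" using assms by simp
  with \<open>b = 0 \<and> c = 0\<close> assms show ?thesis by (auto simp: zmult_eq_1_iff)
qed

text \<open>An incomparable pair has, say, c < a and b < d, so a d - b c >= 1 + b + c, which forces
  b = c = 0. Hence outside the standard basis one vector can be subtracted from the other without
  leaving the quadrant.\<close>

lemma farey_pair_comparable:
  assumes "farey_pair a b c d" "2 < a + b + c + d"
  shows "c \<le> a \<and> d \<le> b \<or> a \<le> c \<and> b \<le> d"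
proof (rule ccontr)
  assume "\<not> ?thesis"
  then consider "c < a" "b < d" | "a < c" "d < b" by linarith
  then show False
  proof cases
    case 1
    then show False using farey_pair_comparable_aux[of b c a d] assms by (simp add: farey_pair_def)
  next
    case 2
    then show False using farey_pair_comparable_aux[of d a c b] assms
      by (simp add: farey_pair_def abs_minus_commute mult.commute)
  qed
qed

lemma farey_pair_basis:
  assumes "farey_pair a b c d" "a + b + c + d \<le> 2"
  shows "a = 1 \<and> b = 0 \<and> c = 0 \<and> d = 1 \<or> a = 0 \<and> b = 1 \<and> c = 1 \<and> d = 0"
proof -
  have "a = 0 \<and> b = 1 \<or> a = 1 \<and> b = 0" "c = 0 \<and> d = 1 \<or> c = 1 \<and> d = 0"
    using farey_pair_sum_pos[OF assms(1)] assms(2) assms(1) unfolding farey_pair_def by linarith+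
  with assms(1) show ?thesis by (auto simp: farey_pair_def)
qed

text \<open>Subtractive Euclidean descent on the sum of the entries. Adding to the second vector
  suffices because \<open>commute\<close> exchanges the two.\<close>

lemma farey_pair_induct [consumes 1, case_names base commute add]:
  assumes "farey_pair a b c d"
    and base: "P 1 0 0 1"
    and comm: "\<And>a b c d. farey_pair a b c d \<Longrightarrow> P a b c d \<Longrightarrow> P c d a b"
    and add: "\<And>a b c d. farey_pair a b c d \<Longrightarrow> P a b c d \<Longrightarrow> P a b (a + c) (b + d)"
  shows "P a b c d"
  using assms(1)
proof (induction "nat (a + b + c + d)" arbitrary: a b c d rule: less_induct)
  case less
  have nb: "farey_pair 1 0 0 1" by (simp add: farey_pair_def)
  show ?case
  proof (cases "a + b + c + d \<le> 2")
    case True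
    then show ?thesis using farey_pair_basis[OF less.prems] base comm[OF nb base] by auto
  next
    case False
    have *: "P a b c d" if "a \<le> c" "b \<le> d" and n: "farey_pair a b c d" and
       e: "nat (a + b + c + d) = n0" and IH: "\<And>a b c d. nat (a + b + c + d) < n0 \<Longrightarrow> farey_pair a b c d \<Longrightarrow> P a b c d" for a b c d n0
    proof -
      have n': "farey_pair a b (c - a) (d - b)" using n that by (simp add: farey_pair_def algebra_simps)
      have "nat (a + b + (c - a) + (d - b)) < n0"
        using farey_pair_sum_pos[OF n] farey_pair_nonneg[OF n] e by linarith
      from add[OF n' IH[OF this n']] show ?thesis by simp
    qed
    from farey_pair_comparable[OF less.prems] False have "c \<le> a \<and> d \<le> b \<or> a \<le> c \<and> b \<le> d" by simp
    then show ?thesis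
    proof
      assume "c \<le> a \<and> d \<le> b"
      then have "P c d a b"
        using *[of c a d b "nat (a + b + c + d)"] farey_pair_commute[OF less.prems] less.hyps
        by (simp add: add_ac)
      from comm[OF farey_pair_commute[OF less.prems] this] show ?thesis .
    next
      assume "a \<le> c \<and> b \<le> d"
      then show ?thesis using *[OF _ _ less.prems refl] less.hyps by blast
    qed
  qed
qed

section \<open>Trace identity and Markov equation\<close>

lemma mtrace_base: "mtrace 1 0 = 3" "mtrace 0 1 = 3" "mtrace 1 1 = 6"
  using gen_markov_base by (simp_all add: mtrace_def)

text \<open>This is tr(AB) + tr(AB^-1) = tr A tr B. The standard basis is left out: the absolute
  values would turn its difference (1,-1) into (1,1), and 6 = 9 - 6 fails.\<close>

lemma mtrace_add:
  assumes "farey_pair a b c d" "2 < a + b + c + d"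
  shows "mtrace (a + c) (b + d) = mtrace a b * mtrace c d - mtrace \<bar>a - c\<bar> \<bar>b - d\<bar>"
proof -
  have nn: "0 \<le> a" "0 \<le> b" "0 \<le> c" "0 \<le> d" using assms(1) by (simp_all add: farey_pair_def)
  have "{(nat a, nat b), (nat c, nat d)} \<noteq> {(1, 0), (0, 1)}"
    using assms(2) nn by (auto simp: doubleton_eq_iff)
  moreover have "\<bar>int (nat a) * int (nat d) - int (nat b) * int (nat c)\<bar> = 1"
    using assms(1) by (simp add: farey_pair_def)
  ultimately have "gen_markov (nat a + nat c) (nat b + nat d) =
    3 * gen_markov (nat a) (nat b) * gen_markov (nat c) (nat d)
      - gen_markov (nat \<bar>a - c\<bar>) (nat \<bar>b - d\<bar>)"
    using gen_markov_farey[of "nat a" "nat d" "nat b" "nat c"] nn by simp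
  then show ?thesis using nn by (simp add: mtrace_def nat_add_distrib)
qed

text \<open>The Vieta jump replacing y by x z - y keeps the equation. The inequalities ride along
  because x >= 3 and y <= z keep the new value the largest.\<close>

lemma mtrace_triple:
  assumes "farey_pair a b c d"
  shows "3 \<le> mtrace a b \<and> 3 \<le> mtrace c d \<and>
    mtrace a b \<le> mtrace (a + c) (b + d) \<and> mtrace c d \<le> mtrace (a + c) (b + d) \<and>
    (mtrace a b)\<^sup>2 + (mtrace c d)\<^sup>2 + (mtrace (a + c) (b + d))\<^sup>2
      = mtrace a b * mtrace c d * mtrace (a + c) (b + d)"
  using assms
proof (induction rule: farey_pair_induct)
  case base
  then show ?case by (simp add: mtrace_base)
next
  case (commute a b c d)
  then show ?case by (simp add: add.commute mult_ac)
next
  case (add a b c d)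
  define x y z where xyz: "x = mtrace a b" "y = mtrace c d" "z = mtrace (a + c) (b + d)"
  have nn: "0 \<le> a" "0 \<le> b" "0 \<le> c" "0 \<le> d" using add(1) by (simp_all add: farey_pair_def)
  have "2 < a + b + (a + c) + (b + d)" using farey_pair_sum_pos[OF add(1)] by linarith
  from mtrace_add[OF farey_pair_add[OF add(1)] this]
  have *: "mtrace (a + (a + c)) (b + (b + d)) = x * z - y" using nn by (simp add: xyz)
  have h: "3 \<le> x" "3 \<le> y" "x \<le> z" "y \<le> z" "x\<^sup>2 + y\<^sup>2 + z\<^sup>2 = x * y * z"
    using add(2) by (simp_all add: xyz)
  have "3 * z \<le> x * z" using h by (intro mult_right_mono) auto
  then have "z \<le> x * z - y" using h by linarith
  moreover have "x\<^sup>2 + z\<^sup>2 + (x * z - y)\<^sup>2 = x * z * (x * z - y)"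
    using h(5) by (simp add: power2_eq_square algebra_simps)
  ultimately show ?case using h unfolding * by (simp flip: xyz)
qed

lemma mtrace_add_le:
  assumes "farey_pair a b c d"
  shows "mtrace (a + c) (b + d) \<le> mtrace a b * mtrace c d"
proof (cases "a + b + c + d \<le> 2")
  case True
  from farey_pair_basis[OF assms True] show ?thesis by (auto simp: mtrace_base)
next
  case False
  have "0 \<le> mtrace \<bar>a - c\<bar> \<bar>b - d\<bar>"
  proof -
    have "c \<le> a \<and> d \<le> b \<or> a \<le> c \<and> b \<le> d" using farey_pair_comparable[OF assms] False by simp
    then have "farey_pair \<bar>a - c\<bar> \<bar>b - d\<bar> c d" using assms unfolding farey_pair_def
      by (elim disjE) (simp_all add: algebra_simps abs_minus_commute)
    from mtrace_triple[OF this] show ?thesis by simp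
  qed
  with mtrace_add[OF assms] False show ?thesis by simp
qed

section \<open>Lengths and the exponential form of traces along a Farey sequence\<close>

definition len :: "int \<Rightarrow> int \<Rightarrow> real" where
  "len x y = arcosh (mtrace x y / 2)"

text \<open>The coefficients in \<open>mtrace ((c, d) + j (a, b)) = lead e\<^sup>j\<^sup>L + trail e\<^sup>-\<^sup>j\<^sup>L\<close> with
  \<open>L = len a b\<close>. The right slope of the norm at \<open>(a, b)\<close> takes \<open>(c, d)\<close> to \<open>ln lead\<close>.\<close>

definition lead :: "int \<Rightarrow> int \<Rightarrow> int \<Rightarrow> int \<Rightarrow> real" where
  "lead a b c d = (mtrace (a + c) (b + d) - exp (- len a b) * mtrace c d) / (exp (len a b) - exp (- len a b))"

definition trail :: "int \<Rightarrow> int \<Rightarrow> int \<Rightarrow> int \<Rightarrow> real" where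
  "trail a b c d = (exp (len a b) * mtrace c d - mtrace (a + c) (b + d)) / (exp (len a b) - exp (- len a b))"

lemma len_pos: "3 \<le> mtrace a b \<Longrightarrow> 0 < len a b"
  unfolding len_def by simp

lemma mtrace_len: "3 \<le> mtrace a b \<Longrightarrow> mtrace a b = exp (len a b) + exp (- len a b)"
  using cosh_arcosh_real[of "mtrace a b / 2"] by (simp add: len_def cosh_field_def)

lemma farey_pair_len:
  assumes "farey_pair a b c d"
  shows "0 < len a b" "mtrace a b = exp (len a b) + exp (- len a b)" "0 < exp (len a b) - exp (- len a b)"
    "0 < len c d" "mtrace c d = exp (len c d) + exp (- len c d)" "0 < exp (len c d) - exp (- len c d)"
  using mtrace_triple[OF assms] len_pos mtrace_len by simp_all

lemma coth_gt_1:
  assumes "0 < l" shows "1 < (exp l + exp (- l)) / (exp l - exp (- l :: real))"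
  using assms by (simp add: field_simps)

text \<open>With l = e^L and k = e^(-L) the numerators multiply to (l + k) y z - y^2 - z^2, which
  the Markov equation turns into (l + k)^2. A positive product and a positive sum make both
  coefficients positive.\<close>

lemma lead_trail:
  assumes "farey_pair a b c d"
  shows "lead a b c d + trail a b c d = mtrace c d"
    and "lead a b c d * exp (len a b) + trail a b c d * exp (- len a b) = mtrace (a + c) (b + d)"
    and "lead a b c d * trail a b c d = ((exp (len a b) + exp (- len a b)) / (exp (len a b) - exp (- len a b)))\<^sup>2"
    and "0 < lead a b c d" and "0 < trail a b c d"
proof -
  define l where "l = exp (len a b)"
  define k where "k = exp (- len a b)"
  have lk: "l * k = 1" "0 < l - k" "mtrace a b = l + k"
    using farey_pair_len[OF assms] by (simp_all add: l_def k_def flip: exp_add)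
  define y z where "y = mtrace c d" and "z = mtrace (a + c) (b + d)"
  have lead: "lead a b c d = (z - k * y) / (l - k)" "trail a b c d = (l * y - z) / (l - k)"
    by (simp_all add: lead_def trail_def l_def k_def y_def z_def)
  show 1: "lead a b c d + trail a b c d = mtrace c d"
  proof -
    have "lead a b c d + trail a b c d = ((z - k * y) + (l * y - z)) / (l - k)"
      unfolding lead by (simp only: add_divide_distrib)
    also have "\<dots> = y" using lk by (simp add: divide_eq_eq algebra_simps)
    finally show ?thesis by (simp add: y_def)
  qed
  have "lead a b c d * l + trail a b c d * k = ((z - k * y) * l + (l * y - z) * k) / (l - k)"
    unfolding lead by (simp add: add_divide_distrib)
  also have "(z - k * y) * l + (l * y - z) * k = z * (l - k)" by (simp add: algebra_simps)
  also have "z * (l - k) / (l - k) = z" using lk by simp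
  finally show "lead a b c d * exp (len a b) + trail a b c d * exp (- len a b) = mtrace (a + c) (b + d)"
    by (simp add: l_def k_def z_def)
  have "(l + k)\<^sup>2 + y\<^sup>2 + z\<^sup>2 = (l + k) * y * z" and y: "3 \<le> y"
    using mtrace_triple[OF assms] lk by (simp_all add: y_def z_def)
  moreover have "(z - k * y) * (l * y - z) = (l + k) * y * z - (l * k) * y\<^sup>2 - z\<^sup>2"
    by (simp add: power2_eq_square algebra_simps)
  ultimately have "(z - k * y) * (l * y - z) = (l + k)\<^sup>2" using lk by simp
  then have 2: "lead a b c d * trail a b c d = ((l + k) / (l - k))\<^sup>2"
    unfolding lead by (simp add: power2_eq_square)
  then show "lead a b c d * trail a b c d = ((exp (len a b) + exp (- len a b)) / (exp (len a b) - exp (- len a b)))\<^sup>2"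
    by (simp add: l_def k_def)
  have "0 < l + k" by (simp add: l_def k_def add_pos_pos)
  then have "0 < lead a b c d * trail a b c d" unfolding 2 using lk by simp
  moreover have "0 < lead a b c d + trail a b c d" using 1 y by (simp add: y_def)
  ultimately show "0 < lead a b c d" "0 < trail a b c d" by (auto simp: zero_less_mult_iff)
qed

lemma lead_trail_gt_1:
  assumes "farey_pair a b c d" shows "1 < lead a b c d * trail a b c d"
  unfolding lead_trail(3)[OF assms] using coth_gt_1[OF farey_pair_len(1)[OF assms]] by simp

lemma lead_add:
  assumes "farey_pair a b c d"
  shows "lead a b (a + c) (b + d) = lead a b c d * exp (len a b)"
    and "trail a b (a + c) (b + d) = trail a b c d * exp (- len a b)"
proof -
  have nn: "0 \<le> a" "0 \<le> b" "0 \<le> c" "0 \<le> d" using assms by (simp_all add: farey_pair_def)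
  have "2 < a + b + (a + c) + (b + d)" using farey_pair_sum_pos[OF assms] by linarith
  from mtrace_add[OF farey_pair_add[OF assms] this]
  have *: "mtrace (a + (a + c)) (b + (b + d)) =
    (exp (len a b) + exp (- len a b)) * mtrace (a + c) (b + d) - mtrace c d"
    using nn farey_pair_len(2)[OF assms] by simp
  have e: "exp (len a b) * exp (- len a b) = 1" by (simp flip: exp_add)
  show "lead a b (a + c) (b + d) = lead a b c d * exp (len a b)"
    unfolding lead_def * using e by (simp add: field_simps)
  show "trail a b (a + c) (b + d) = trail a b c d * exp (- len a b)"
    unfolding trail_def * using e by (simp add: field_simps)
qed

lemma lead_add_mult:
  assumes "farey_pair a b c d"
  shows "lead a b (c + int j * a) (d + int j * b) = lead a b c d * exp (j * len a b) \<and>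
    trail a b (c + int j * a) (d + int j * b) = trail a b c d * exp (- (j * len a b))"
proof (induction j)
  case (Suc j)
  have e: "c + int (Suc j) * a = a + (c + int j * a)" "d + int (Suc j) * b = b + (d + int j * b)"
    by (simp_all add: algebra_simps)
  show ?case unfolding e lead_add[OF farey_pair_add_mult[OF assms]]
    using Suc by (simp add: distrib_right exp_add exp_diff exp_minus divide_inverse)
qed simp

text \<open>A slope at (a,b) must grow by \<open>len a b\<close> when (a,b) is added. Negative i is
  allowed within the quadrant and is read as a forward shift from the new pair.\<close>

lemma ln_lead_shift:
  assumes "farey_pair a b c d" "0 \<le> c + i * a" "0 \<le> d + i * b"
  shows "farey_pair a b (c + i * a) (d + i * b)"
    and "ln (lead a b (c + i * a) (d + i * b)) = ln (lead a b c d) + i * len a b"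
proof -
  show n: "farey_pair a b (c + i * a) (d + i * b)" using assms by (simp add: farey_pair_def algebra_simps)
  show "ln (lead a b (c + i * a) (d + i * b)) = ln (lead a b c d) + i * len a b"
  proof (cases "0 \<le> i")
    case True
    then show ?thesis using lead_add_mult[OF assms(1), of "nat i"] lead_trail(4)[OF assms(1)]
      by (simp add: ln_mult)
  next
    case False
    then show ?thesis using lead_add_mult[OF n, of "nat (- i)"] lead_trail(4)[OF n]
      by (simp add: ln_mult)
  qed
qed

text \<open>With x = e^(len c d), the pairs p, q and x, 1/x have the same sum, but p q > 1. The
  larger product puts p and q strictly between 1/x and x.\<close>

lemma ln_lead_le_len:
  assumes "farey_pair a b c d"
  shows "ln (lead a b c d) \<le> len c d"
proof (rule ccontr)
  define p q x where "p = lead a b c d" and "q = trail a b c d" and "x = exp (len c d)"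
  assume "\<not> ?thesis"
  then have xp: "x < p" using lead_trail(4)[OF assms]
    using exp_less_mono[of "len c d" "ln p"] by (simp add: x_def p_def not_le)
  have x: "1 < x" "x + 1 / x = p + q" "1 < p * q" "0 < p"
    using farey_pair_len[OF assms] lead_trail[OF assms] lead_trail_gt_1[OF assms]
    by (simp_all add: x_def p_def q_def exp_minus inverse_eq_divide)
  have "x * p + p / x = p * p + p * q" using x(2) by (metis distrib_left mult.commute times_divide_eq_right mult.right_neutral)
  then have "p * (p - x) + p * q = p / x" by (simp add: algebra_simps)
  moreover have "p / x - 1 = (p - x) / x" using x by (simp add: field_simps)
  moreover have "(p - x) / x \<le> p * (p - x)"
  proof -
    have "(p - x) * 1 \<le> (p - x) * x" using x xp by (intro mult_left_mono) auto
    then have "(p - x) / x \<le> (p - x) * 1" using x by (simp add: pos_divide_le_eq)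
    also have "\<dots> \<le> (p - x) * p" using x xp by (intro mult_left_mono) auto
    finally show ?thesis by (simp add: mult.commute)
  qed
  ultimately show False using x by linarith
qed

text \<open>This is the corner at (a,b): (e,f) is a neighbour on the other side, and a single linear
  functional would give the two values the sum m L. Both coordinates of (a,b) are positive, since
  the other side of an axis is outside the quadrant.\<close>

lemma farey_pair_opposite:
  assumes "farey_pair a b c d" "1 \<le> a" "1 \<le> b"
  shows "\<exists>e f (m::int). farey_pair a b e f \<and> e + c = m * a \<and> f + d = m * b \<and>
    ln (lead a b c d) + ln (lead a b e f)
      = m * len a b + 2 * ln ((exp (len a b) + exp (- len a b)) / (exp (len a b) - exp (- len a b)))"
  using assms(1)
proof (induction "nat (c + d)" arbitrary: c d rule: less_induct)
  case less
  have s: "2 < a + b + c + d" using farey_pair_sum_pos[OF less.prems] assms by linarith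
  let ?C = "ln ((exp (len a b) + exp (- len a b)) / (exp (len a b) - exp (- len a b)))"
  from farey_pair_comparable[OF less.prems s] show ?case
  proof
    assume le: "c \<le> a \<and> d \<le> b"
    \<comment> \<open>Here (a,b) is the sum of (c,d) and its complement, so the complement is the
      opposite neighbour and m = 1.\<close>
    have n: "farey_pair a b (a - c) (b - d)" using less.prems le by (simp add: farey_pair_def algebra_simps abs_minus_commute)
    have e: "exp (len a b) * exp (- len a b) = 1" by (simp flip: exp_add)
    have m: "mtrace (a + (a - c)) (b + (b - d)) = (exp (len a b) + exp (- len a b)) * mtrace (a - c) (b - d) - mtrace c d"
      using farey_pair_len(2)[OF n] mtrace_add[OF n] farey_pair_sum_pos[OF n] assms farey_pair_nonneg[OF less.prems] by simp
    have m': "mtrace (a + c) (b + d) = (exp (len a b) + exp (- len a b)) * mtrace c d - mtrace (a - c) (b - d)"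
      using farey_pair_len(2)[OF n] mtrace_add[OF less.prems s] le by simp
    \<comment> \<open>Towards the complement the same two-sided sequence is read backwards, which
      makes the coefficient of e^(-jL) the leading one; starting one step away gives the factor
      e^L.\<close>
    have "lead a b (a - c) (b - d) = trail a b c d * exp (len a b)"
      unfolding lead_def trail_def m m' times_divide_eq_left using e
      by (intro arg_cong2[of _ _ _ _ "(/)"]) (simp_all add: algebra_simps)
    then have "ln (lead a b (a - c) (b - d)) = ln (trail a b c d) + len a b"
      using lead_trail(5)[OF less.prems] by (simp add: ln_mult)
    moreover have "ln (lead a b c d) + ln (trail a b c d) = 2 * ?C"
    proof -
      have "ln (lead a b c d) + ln (trail a b c d) = ln (lead a b c d * trail a b c d)"
        using lead_trail(4,5)[OF less.prems] by (simp add: ln_mult)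
      also have "\<dots> = 2 * ?C" unfolding lead_trail(3)[OF less.prems]
        using coth_gt_1[OF farey_pair_len(1)[OF n]] by (subst ln_realpow) auto
      finally show ?thesis .
    qed
    ultimately show ?case using n
      by (intro exI[of _ "a - c"] exI[of _ "b - d"] exI[of _ 1]) simp
  next
    assume le: "a \<le> c \<and> b \<le> d"
    have n: "farey_pair a b (c - a) (d - b)" using less.prems le by (simp add: farey_pair_def algebra_simps)
    have "nat (c - a + (d - b)) < nat (c + d)" using assms le farey_pair_nonneg[OF less.prems] by linarith
    from less.hyps[OF this n] obtain e f m where *: "farey_pair a b e f" "e + (c - a) = m * a" "f + (d - b) = m * b"
      "ln (lead a b (c - a) (d - b)) + ln (lead a b e f) = m * len a b + 2 * ?C"
      by blast
    have "lead a b c d = lead a b (c - a) (d - b) * exp (len a b)" using lead_add(1)[OF n] by simp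
    then have "ln (lead a b c d) = ln (lead a b (c - a) (d - b)) + len a b"
      using lead_trail(4)[OF n] by (simp add: ln_mult)
    then show ?case using *
      by (intro exI[of _ e] exI[of _ f] exI[of _ "m + 1"]) (simp add: algebra_simps)
  qed
qed


section \<open>Support functionals and log-convexity\<close>

lemma coprime_nb_exists:
  assumes "coprime x y" "0 \<le> x" "0 \<le> (y :: int)"
  obtains c d where "farey_pair x y c d"
proof -
  consider "x = 0" | "y = 0" | "nat x \<noteq> 0" "nat y \<noteq> 0" using assms by linarith
  then show thesis
  proof cases
    case 1
    then have "y = 1" using assms by simp
    with 1 show ?thesis using that[of 1 0] by (simp add: farey_pair_def)
  next
    case 2
    then have "x = 1" using assms by simp
    with 2 show ?thesis using that[of 0 1] by (simp add: farey_pair_def)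
  next
    case 3
    have "coprime (nat x) (nat y)" using assms by (simp flip: coprime_int_iff)
    from det_decompose_exists[OF this 3] obtain a b c d where
      *: "nat x = a + c" "nat y = b + d" "\<bar>int a * int d - int b * int c\<bar> = 1" .
    then have "x = int a + int c" "y = int b + int d" using assms by linarith+
    then have "farey_pair x y (int c) (int d)" using * assms by (simp add: farey_pair_def algebra_simps)
    then show ?thesis by (rule that)
  qed
qed

lemma coprime_len:
  assumes "coprime x y" "0 \<le> x" "0 \<le> y"
  shows "0 < len x y" "mtrace x y = exp (len x y) + exp (- len x y)" "0 < exp (len x y) - exp (- len x y)"
    "3 \<le> mtrace x y"
proof -
  obtain c d where n: "farey_pair x y c d" using coprime_nb_exists[OF assms] .
  show "0 < len x y" "mtrace x y = exp (len x y) + exp (- len x y)" "0 < exp (len x y) - exp (- len x y)"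
    using farey_pair_len[OF n] by auto
  show "3 \<le> mtrace x y" using mtrace_triple[OF n] by simp
qed

lemma mtrace_mult_Suc:
  assumes "coprime x y" "0 \<le> x" "0 \<le> y"
  shows "mtrace (int (Suc (Suc n)) * x) (int (Suc (Suc n)) * y)
      = mtrace x y * mtrace (int (Suc n) * x) (int (Suc n) * y) - mtrace (int n * x) (int n * y)"
proof -
  have cop: "coprime (nat x) (nat y)" using assms by (simp flip: coprime_int_iff)
  have *: "mtrace (int n * x) (int n * y) = 3 * markov_mult (gen_markov (nat x) (nat y)) n" for n
    unfolding mtrace_def gen_markov_multiple[OF cop, symmetric] by (simp only: nat_mult_distrib of_nat_0_le_iff nat_int)
  show ?thesis unfolding * by (simp add: mtrace_def)
qed

text \<open>The recurrence is that of e^(nL) - e^(-nL), but the value at n = 1 is e^L + e^(-L). The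
  quotient coth L is the source of the excess at imprimitive points.\<close>

lemma mtrace_mult:
  assumes "coprime x y" "0 \<le> x" "0 \<le> y"
  shows "mtrace (int n * x) (int n * y) = (exp (len x y) + exp (- len x y)) / (exp (len x y) - exp (- len x y))
     * (exp (n * len x y) - exp (- (n * len x y)))"
proof (induction n rule: induct_nat_012)
  case 0
  then show ?case by (simp add: mtrace_def gen_markov_def)
next
  case 1
  then show ?case using coprime_len[OF assms] by simp
next
  case (ge2 n)
  define l k where "l = exp (len x y)" and "k = exp (- len x y)"
  define ln kn where "ln = exp (n * len x y)" and "kn = exp (- (n * len x y))"
  have "l * k = 1" unfolding l_def k_def by (simp flip: exp_add)
  have s: "exp (Suc n * len x y) = l * ln" "exp (- (Suc n * len x y)) = k * kn"
    "exp (Suc (Suc n) * len x y) = l * (l * ln)" "exp (- (Suc (Suc n) * len x y)) = k * (k * kn)"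
    by (simp_all add: l_def k_def ln_def kn_def flip: exp_add) (simp_all add: algebra_simps)
  have "l * (l * ln) - k * (k * kn) = (l + k) * (l * ln - k * kn) - (l * k) * ln + (l * k) * kn"
    by (simp add: algebra_simps)
  then have e: "l * (l * ln) - k * (k * kn) = (l + k) * (l * ln - k * kn) - (ln - kn)"
    using \<open>l * k = 1\<close> by simp
  have m: "mtrace x y = l + k" using coprime_len[OF assms] by (simp add: l_def k_def)
  have r: "C * (l * (l * ln) - k * (k * kn)) = (l + k) * (C * (l * ln - k * kn)) - C * (ln - kn)" for C
    unfolding e by (simp add: algebra_simps)
  show ?case unfolding mtrace_mult_Suc[OF assms] ge2(1) ge2(2) s m
    unfolding l_def[symmetric] k_def[symmetric] ln_def[symmetric] kn_def[symmetric] by (rule r[symmetric])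
qed

definition lcoth :: "int \<Rightarrow> int \<Rightarrow> real" where
  "lcoth x y = ln ((exp (len x y) + exp (- len x y)) / (exp (len x y) - exp (- len x y)))"

lemma mtrace_mult_bounds:
  assumes "coprime x y" "0 \<le> x" "0 \<le> y" "1 \<le> n"
  shows "0 < mtrace (int n * x) (int n * y)"
    and "ln (mtrace (int n * x) (int n * y)) < n * len x y + lcoth x y"
    and "n * len x y \<le> ln (mtrace (int n * x) (int n * y))"
    and "0 < lcoth x y"
proof -
  note len = coprime_len[OF assms(1-3)]
  define l k where "l = exp (len x y)" and "k = exp (- len x y)"
  define C where "C = (l + k) / (l - k)"
  define ln kn where "ln = exp (n * len x y)" and "kn = exp (- (n * len x y))"
  have C: "1 < C" "lcoth x y = Transcendental.ln C" using coth_gt_1[OF len(1)]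
    by (simp_all add: C_def l_def k_def lcoth_def)
  then show "0 < lcoth x y" by simp
  have m: "mtrace (int n * x) (int n * y) = C * (ln - kn)"
    using mtrace_mult[OF assms(1-3)] by (simp add: C_def l_def k_def ln_def kn_def)
  have nl: "len x y \<le> n * len x y" using len assms(4) by simp
  have k: "0 < k" "k < l" "l * k = 1" "0 < kn" "kn \<le> k" "0 < ln" "ln * kn = 1" "l \<le> ln"
    using len nl by (simp_all add: k_def kn_def l_def ln_def flip: exp_add)
  show pos: "0 < mtrace (int n * x) (int n * y)" using C k by (simp add: m)
  have "mtrace (int n * x) (int n * y) < C * ln" using C k by (simp add: m)
  then have "Transcendental.ln (mtrace (int n * x) (int n * y)) < Transcendental.ln (C * ln)" using pos by (subst ln_less_cancel_iff) auto
  also have "\<dots> = n * len x y + lcoth x y" using C k by (simp add: ln_mult) (simp add: ln_def)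
  finally show "Transcendental.ln (mtrace (int n * x) (int n * y)) < n * len x y + lcoth x y" .
  \<comment> \<open>Cleared of denominators, the lower bound reads kn (l + k) <= 2 k
    \<open>ln\<close>, where \<open>ln\<close> denotes e^(nL).\<close>
  have "kn * (l + k) \<le> k * (l + k)" using k by (intro mult_right_mono) auto
  also have "\<dots> = k * k + k * l" by (simp add: algebra_simps)
  also have "\<dots> \<le> k * ln + k * ln" using k by (intro add_mono mult_left_mono) auto
  also have "kn * (l + k) = kn * l + kn * k" by (simp add: algebra_simps)
  finally have "ln * (l - k) \<le> (l + k) * (ln - kn)" by (simp add: algebra_simps)
  then have "ln \<le> mtrace (int n * x) (int n * y)" unfolding m C_def using k by (simp add: field_simps)
  then have "Transcendental.ln ln \<le> Transcendental.ln (mtrace (int n * x) (int n * y))" using k pos by simp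
  then show "n * len x y \<le> Transcendental.ln (mtrace (int n * x) (int n * y))" by (simp add: ln_def)
qed

lemma primitive_multiple:
  fixes x y :: int
  assumes "0 \<le> x" "0 \<le> y" "x \<noteq> 0 \<or> y \<noteq> 0"
  obtains n a b where "1 \<le> n" "coprime a b" "0 \<le> a" "0 \<le> b" "x = int n * a" "y = int n * b"
proof -
  define g where "g = gcd x y"
  have g: "0 < g" using assms(3) by (simp add: g_def)
  define a b where "a = x div g" and "b = y div g"
  have ab: "x = g * a" "y = g * b" by (simp_all add: a_def b_def g_def)
  have "coprime a b" using div_gcd_coprime[OF assms(3)] by (simp add: a_def b_def g_def)
  moreover have "0 \<le> a" "0 \<le> b" using ab assms g by (simp_all add: zero_le_mult_iff)
  ultimately show thesis using that[of "nat g" a b] ab g by simp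
qed

section \<open>Linear functionals below the length\<close>

definition supports :: "real \<Rightarrow> real \<Rightarrow> bool" where
  "supports u v \<longleftrightarrow> (\<forall>x y. 0 \<le> x \<longrightarrow> 0 \<le> y \<longrightarrow> coprime x y \<longrightarrow> u * x + v * y \<le> len x y)"

text \<open>The bound is asked only at the primitive vector of (x,y), since
  \<open>diag_support\<close> provides it only below the diagonal.\<close>

lemma linear_le_ln_mtrace:
  fixes u v :: real
  assumes "\<And>a b. coprime a b \<Longrightarrow> 0 \<le> a \<Longrightarrow> 0 \<le> b \<Longrightarrow> \<exists>n. x = int n * a \<and> y = int n * b \<Longrightarrow> u * a + v * b \<le> len a b"
     "0 \<le> x" "0 \<le> y" "x \<noteq> 0 \<or> y \<noteq> 0"
  shows "u * x + v * y \<le> ln (mtrace x y)"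
proof -
  obtain n a b where *: "1 \<le> n" "coprime a b" "0 \<le> a" "0 \<le> b" "x = int n * a" "y = int n * b"
    using primitive_multiple[OF assms(2-4)] .
  have "u * x + v * y = n * (u * a + v * b)" using * by (simp add: algebra_simps)
  also have "\<dots> \<le> n * len a b" using assms(1)[of a b] * by (intro mult_left_mono) auto
  also have "\<dots> \<le> ln (mtrace x y)" using mtrace_mult_bounds(3)[OF *(2-4,1)] * by simp
  finally show ?thesis .
qed

lemma mtrace_pos:
  assumes "0 \<le> x" "0 \<le> y" "x \<noteq> 0 \<or> y \<noteq> 0"
  shows "0 < mtrace x y"
proof -
  obtain n a b where *: "1 \<le> n" "coprime a b" "0 \<le> a" "0 \<le> b" "x = int n * a" "y = int n * b"
    using primitive_multiple[OF assms] .
  then show ?thesis using mtrace_mult_bounds(1)[OF *(2-4,1)] by simp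
qed

text \<open>Induction on the determinant t of (a,b) and (x,y). A neighbour (V,W) of (a,b) is placed
  between them, with (x,y) = t (V,W) - s (a,b) and 0 < s < t, so that (V,W) sees (x,y) with
  determinant s. The slope at (V,W) away from (a,b) bounds \<open>len x y\<close> by induction, and
  passing across the corner at (V,W) only lowers the bound. For t = 1 the point (x,y) is itself a
  neighbour and \<open>ln_lead_le_len\<close> suffices.\<close>

lemma support_ineq:
  fixes x y j t :: int
  assumes "farey_pair a b c d" "0 \<le> x" "0 \<le> y" "coprime x y" "x = j * a + t * c" "y = j * b + t * d" "1 \<le> t"
  shows "j * len a b + t * ln (lead a b c d) \<le> len x y"
  using assms
proof (induction "nat t" arbitrary: a b c d j t rule: less_induct)
  case less
  note nn = farey_pair_nonneg[OF less.prems(1)]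
  show ?case
  proof (cases "t = 1")
    case True
    then have xy: "x = c + j * a" "y = d + j * b" using less.prems(5,6) by simp_all
    have n: "0 \<le> c + j * a" "0 \<le> d + j * b" using less.prems(2,3) unfolding xy .
    show ?thesis unfolding xy
      using ln_lead_shift(2)[OF less.prems(1) n] ln_lead_le_len[OF ln_lead_shift(1)[OF less.prems(1) n]] True
      by simp
  next
    case False
    \<comment> \<open>i is j / t rounded up and s = t i - j. If s were 0, t would be a common
      divisor of x and y.\<close>
    define s i where "s = (- j) mod t" and "i = - ((- j) div t)"
    have "t * ((- j) div t) + s = - j" by (simp add: s_def)
    then have j: "j = t * i - s" by (simp add: i_def)
    have "0 \<le> s" "s < t" using less.prems(7) by (simp_all add: s_def)
    moreover have "s \<noteq> 0"
    proof
      assume "s = 0"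
      then have "t dvd x" "t dvd y" using less.prems(5,6) j by simp_all
      then have "is_unit t" using less.prems(4) by (meson coprime_common_divisor)
      then show False using False less.prems(7) by simp
    qed
    ultimately have s: "1 \<le> s" "s < t" by linarith+
    define V W where "V = c + i * a" and "W = d + i * b"
    have V: "x = t * V - s * a" "y = t * W - s * b"
      unfolding less.prems(5,6) V_def W_def j by (simp_all add: algebra_simps)
    have "0 \<le> s * a" "0 \<le> s * b" using s nn by simp_all
    then have "0 \<le> t * V" "0 \<le> t * W" using V less.prems by linarith+
    then have V0: "0 \<le> V" "0 \<le> W" using less.prems(7) by (simp_all add: zero_le_mult_iff)
    then have n1: "farey_pair a b V W" and l1: "ln (lead a b V W) = ln (lead a b c d) + i * len a b"
      using ln_lead_shift[OF less.prems(1), of i] by (simp_all add: V_def W_def)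
    have n2: "farey_pair V W a b" using farey_pair_commute[OF n1] .
    have VW: "1 \<le> V" "1 \<le> W"
    proof -
      have "V \<noteq> 0"
      proof
        assume "V = 0"
        then have "x = - (s * a)" using V by simp
        then have "s * a = 0" using less.prems(2) \<open>0 \<le> s * a\<close> by linarith
        then have "a = 0" using s by simp
        then show False using \<open>V = 0\<close> n1 by (simp add: farey_pair_def)
      qed
      moreover have "W \<noteq> 0"
      proof
        assume "W = 0"
        then have "y = - (s * b)" using V by simp
        then have "s * b = 0" using less.prems(3) \<open>0 \<le> s * b\<close> by linarith
        then have "b = 0" using s by simp
        then show False using \<open>W = 0\<close> n1 by (simp add: farey_pair_def)
      qed
      ultimately show "1 \<le> V" "1 \<le> W" using V0 by linarith+
    qed
    obtain e f and m :: int where opp: "farey_pair V W e f" "e + a = m * V" "f + b = m * W"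
      "ln (lead V W a b) + ln (lead V W e f) = m * len V W + 2 * lcoth V W"
      using farey_pair_opposite[OF n2 VW] unfolding lcoth_def by blast
    have ab: "a = m * V - e" "b = m * W - f" using opp by linarith+
    have "(t - s * m) * len V W + s * ln (lead V W e f) \<le> len x y"
    proof -
      \<comment> \<open>Substituting a = m V - e and b = m W - f gives coordinates with respect to
        (V,W) and (e,f); the second one is s < t.\<close>
      have "x = (t - s * m) * V + s * e" "y = (t - s * m) * W + s * f" unfolding V ab
        by (simp_all add: algebra_simps)
      moreover have "nat s < nat t" using s by simp
      ultimately show ?thesis using less.hyps[OF _ opp(1) less.prems(2-4)] s by blast
    qed
    moreover have "0 < lcoth V W"
      using mtrace_mult_bounds(4)[of V W 1] farey_pair_coprime[OF n2] V0 by simp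
    moreover have "t * ln (lead a b V W) \<le> t * len V W"
      using ln_lead_le_len[OF n1] less.prems(7) by (intro mult_left_mono) auto
    \<comment> \<open>By the corner, m \<open>len V W\<close> - \<open>ln (lead V W e f)\<close> is
      \<open>ln (lead V W a b)\<close> minus a positive amount, hence at most
      \<open>len a b\<close>.\<close>
    moreover have "s * (m * len V W - ln (lead V W e f)) \<le> s * len a b"
      using ln_lead_le_len[OF n2] opp(4) \<open>0 < lcoth V W\<close> s by (intro mult_left_mono) auto
    ultimately show ?thesis unfolding j by (simp add: l1 algebra_simps)
  qed
qed

lemma supports_exist:
  assumes "coprime a b" "1 \<le> a" "1 \<le> b"
  obtains u v u' v' :: real where "supports u v" "supports u' v'"
    "u * a + v * b = len a b" "u' * a + v' * b = len a b"
    "\<forall>(x :: real) (y :: real). (u * x + v * y) - (u' * x + v' * y) = 2 * (a * y - b * x) * lcoth a b"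
proof -
  have ab: "0 \<le> a" "0 \<le> b" using assms by linarith+
  obtain c d where n: "farey_pair a b c d" and det: "a * d - b * c = 1"
  proof -
    obtain c d where n: "farey_pair a b c d" using coprime_nb_exists[OF assms(1) ab] .
    show thesis
    proof (cases "a * d - b * c = 1")
      case True
      then show ?thesis using n that by blast
    next
      case False
      then have *: "a * d - b * c = - 1" using n by (auto simp: farey_pair_def abs_if split: if_splits)
      obtain e f and m :: int where opp: "farey_pair a b e f" "e + c = m * a" "f + d = m * b"
        using farey_pair_opposite[OF n assms(2,3)] by auto
      then have ef: "e = m * a - c" "f = m * b - d" by linarith+
      have "a * f - b * e = - (a * d - b * c)" unfolding ef by (simp add: algebra_simps)
      with * have "a * f - b * e = 1" by simp
      then show ?thesis using opp that by blast
    qed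
  qed
  obtain e f and m :: int where opp: "farey_pair a b e f" "e + c = m * a" "f + d = m * b"
    "ln (lead a b c d) + ln (lead a b e f) = m * len a b + 2 * lcoth a b"
    using farey_pair_opposite[OF n assms(2,3)] unfolding lcoth_def by blast
  define L p q where "L = len a b" and "p = ln (lead a b c d)" and "q = ln (lead a b e f)"
  have pq: "p + q = m * L + 2 * lcoth a b" using opp by (simp add: L_def p_def q_def)
  have C: "0 < lcoth a b" using mtrace_mult_bounds(4)[of a b 1] assms ab by simp
  \<comment> \<open>Cramer's rule: (u,v) takes the value L at (a,b) and p at (c,d).\<close>
  define u v where "u = d * L - b * p" and "v = a * p - c * L"
  \<comment> \<open>The functional is tilted about (a,b); by \<open>pq\<close> the new one takes the
    value q at (e,f).\<close>
  define u' v' where "u' = u + 2 * b * lcoth a b" and "v' = v - 2 * a * lcoth a b"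
  have diff: "(u * x + v * y) - (u' * x + v' * y) = 2 * (a * y - b * x) * lcoth a b" for x y :: real
    unfolding u'_def v'_def by (simp add: algebra_simps)
  have "u * a + v * b = (a * d - b * c) * L" unfolding u_def v_def by (simp add: algebra_simps)
  then have at: "u * a + v * b = len a b" using det by (simp add: L_def)
  then have at': "u' * a + v' * b = len a b" using diff[of a b] by simp
  have both: "u * x + v * y \<le> len x y \<and> u' * x + v' * y \<le> len x y"
    if xy: "0 \<le> x" "0 \<le> y" "coprime x y" for x y
  proof -
    define t j where "t = a * y - b * x" and "j = x * d - y * c"
    have "j * a + t * c = (a * d - b * c) * x" "j * b + t * d = (a * d - b * c) * y"
      unfolding t_def j_def by (simp_all add: algebra_simps)
    then have X: "x = j * a + t * c" "y = j * b + t * d" using det by simp_all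
    have df: "(u * x + v * y) - (u' * x + v' * y) = 2 * t * lcoth a b"
      using diff[of x y] by (simp add: t_def)
    have uv: "u * x + v * y = j * L + t * p" unfolding u_def v_def t_def j_def by (simp add: algebra_simps)
    \<comment> \<open>\<open>support_ineq\<close> serves each functional on its own side of the ray
      through (a,b); across the ray it lies below its partner.\<close>
    consider "1 \<le> t" | "t = 0" | "1 \<le> - t" by linarith
    then show ?thesis
    proof cases
      case 1
      then have "j * L + t * p \<le> len x y"
        using support_ineq[OF n xy X] by (simp add: L_def p_def)
      moreover have "0 \<le> 2 * t * lcoth a b" using C 1 by simp
      ultimately show ?thesis using uv df by linarith
    next
      case 2
      then have "j dvd x" "j dvd y" using X by simp_all
      then have "is_unit j" using xy by (meson coprime_common_divisor)
      moreover have "0 \<le> j" using 2 X xy assms by (simp add: zero_le_mult_iff)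
      ultimately have "j = 1" by simp
      then have "x = a" "y = b" using X 2 by simp_all
      then show ?thesis using at at' by simp
    next
      case 3
      have cd: "c = m * a - e" "d = m * b - f" using opp by linarith+
      have "x = (j + t * m) * a + (- t) * e" "y = (j + t * m) * b + (- t) * f"
        using X unfolding cd by (simp_all add: algebra_simps)
      from support_ineq[OF opp(1) xy this 3] have "(j + t * m) * L - t * q \<le> len x y"
        by (simp add: L_def q_def)
      moreover have "u' * x + v' * y = (j + t * m) * L - t * q"
      proof -
        have "t * (p + q) = t * (m * L + 2 * lcoth a b)" using pq by simp
        then show ?thesis using uv df by (simp add: algebra_simps)
      qed
      moreover have "2 * t * lcoth a b \<le> 0" using C 3 by (simp add: mult_le_0_iff)
      ultimately show ?thesis using df by linarith
    qed
  qed
  have "supports u v" "supports u' v'" using both by (simp_all add: supports_def)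
  then show thesis using at at' by (rule that) (use diff in blast)
qed

lemma supports_lnD:
  assumes "supports u v" "0 \<le> x" "0 \<le> y" "x \<noteq> 0 \<or> y \<noteq> 0"
  shows "u * x + v * y \<le> ln (mtrace x y)"
  using linear_le_ln_mtrace assms unfolding supports_def by blast

text \<open>For (v,w) and for -(v,w) the functional belonging to the side of each is used; together
  they gain 2 |t| \<open>lcoth a b\<close>, and |t| >= 1 by integrality. Radial steps are excluded
  because sinh is log-concave, which reverses the inequality along a ray.\<close>

lemma mtrace_log_convex:
  fixes x y v w :: int
  assumes "1 \<le> x" "1 \<le> y" "0 \<le> x + v" "0 \<le> y + w" "0 \<le> x - v" "0 \<le> y - w" "x * w - y * v \<noteq> 0"
  shows "(mtrace x y)\<^sup>2 \<le> mtrace (x + v) (y + w) * mtrace (x - v) (y - w)"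
proof -
  obtain n a b where *: "1 \<le> n" "coprime a b" "0 \<le> a" "0 \<le> b" "x = int n * a" "y = int n * b"
  proof -
    have "0 \<le> x" "0 \<le> y" "x \<noteq> 0 \<or> y \<noteq> 0" using assms(1,2) by auto
    then show thesis using that primitive_multiple[of x y] by blast
  qed
  have "a \<noteq> 0" "b \<noteq> 0" using * assms(1,2) by auto
  then have ab: "1 \<le> a" "1 \<le> b" using *(3,4) by linarith+
  obtain p q p' q' :: real where s: "supports p q" "supports p' q'"
    "p * a + q * b = len a b" "p' * a + q' * b = len a b"
    "\<forall>(x :: real) (y :: real). (p * x + q * y) - (p' * x + q' * y) = 2 * (a * y - b * x) * lcoth a b"
    using supports_exist[OF *(2) ab] .
  note m = mtrace_mult_bounds[OF *(2-4,1)]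
  define t where "t = a * w - b * v"
  have nt: "x * w - y * v = n * t" by (simp add: * t_def algebra_simps)
  then have t: "t \<noteq> 0" using assms(7) by auto
  have nz: "x + v \<noteq> 0 \<or> y + w \<noteq> 0" "x - v \<noteq> 0 \<or> y - w \<noteq> 0"
  proof -
    show "x + v \<noteq> 0 \<or> y + w \<noteq> 0"
    proof (rule ccontr)
      assume "\<not> ?thesis"
      then have "v = - x" "w = - y" by linarith+
      then show False using assms(7) by simp
    qed
    show "x - v \<noteq> 0 \<or> y - w \<noteq> 0"
    proof (rule ccontr)
      assume "\<not> ?thesis"
      then have "v = x" "w = y" by linarith+
      then show False using assms(7) by simp
    qed
  qed
  have dif: "(p * v + q * w) - (p' * v + q' * w) = 2 * t * lcoth a b"
    using s(5)[rule_format, of v w] by (simp add: t_def)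
  have pn: "p * x + q * y = n * len a b" "p' * x + q' * y = n * len a b"
    subgoal unfolding s(3)[symmetric] by (simp add: * algebra_simps)
    subgoal unfolding s(4)[symmetric] by (simp add: * algebra_simps)
    done
  have plus: "n * len a b + (p * v + q * w) \<le> ln (mtrace (x + v) (y + w))"
    "n * len a b + (p' * v + q' * w) \<le> ln (mtrace (x + v) (y + w))"
    using supports_lnD[OF s(1) assms(3,4) nz(1)] supports_lnD[OF s(2) assms(3,4) nz(1)] pn
    by (simp_all add: algebra_simps)
  have minus: "n * len a b - (p * v + q * w) \<le> ln (mtrace (x - v) (y - w))"
    "n * len a b - (p' * v + q' * w) \<le> ln (mtrace (x - v) (y - w))"
    using supports_lnD[OF s(1) assms(5,6) nz(2)] supports_lnD[OF s(2) assms(5,6) nz(2)] pn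
    by (simp_all add: algebra_simps)
  have "2 * (n * len a b + lcoth a b) \<le> ln (mtrace (x + v) (y + w)) + ln (mtrace (x - v) (y - w))"
  proof (cases "1 \<le> t")
    case True
    then have "1 * lcoth a b \<le> t * lcoth a b" using m(4) by (intro mult_right_mono) auto
    then show ?thesis using plus(1) minus(2) dif by simp
  next
    case False
    then have "1 * lcoth a b \<le> (- t) * lcoth a b" using m(4) t by (intro mult_right_mono) auto
    then show ?thesis using plus(2) minus(1) dif by simp
  qed
  then have "2 * ln (mtrace x y) \<le> ln (mtrace (x + v) (y + w)) + ln (mtrace (x - v) (y - w))"
    using m(2) by (simp add: *)
  moreover have pos: "0 < mtrace x y" "0 < mtrace (x + v) (y + w)" "0 < mtrace (x - v) (y - w)"
    using mtrace_pos[of x y] assms(1,2) mtrace_pos[OF assms(3,4) nz(1)] mtrace_pos[OF assms(5,6) nz(2)]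
    by simp_all
  ultimately have "ln ((mtrace x y)\<^sup>2) \<le> ln (mtrace (x + v) (y + w) * mtrace (x - v) (y - w))"
    by (simp add: ln_mult ln_realpow)
  then show ?thesis using pos by simp
qed

text \<open>The point \<open>(e, f)\<close> with its functional \<open>(g, h)\<close> is \<open>(1, 0)\<close> or \<open>(1, 1)\<close>; \<open>\<sigma>\<close> is the orientation of
  \<open>(e, f), (x, y)\<close>. At \<open>(x, y)\<close> the functional on the side of \<open>(e, f)\<close> is at least \<open>(g, h)\<close> on
  \<open>(v, w)\<close>, and the corner gains \<open>2 ln coth\<close> over it.\<close>

lemma mtrace_mono:
  fixes x y v w e f \<sigma> :: int and g h :: real
  assumes "1 \<le> x" "1 \<le> y" "0 \<le> x + v" "0 \<le> y + w" "x + v \<noteq> 0 \<or> y + w \<noteq> 0"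
    and ef: "0 \<le> e" "0 \<le> f" "coprime e f"
    and sg: "\<sigma> = 1 \<or> \<sigma> = - 1" "0 < \<sigma> * (e * y - f * x)" "0 \<le> \<sigma> * (e * w - f * v)" "0 < \<sigma> * (x * w - y * v)"
    and h: "g * e + h * f = len e f" "0 \<le> g * v + h * w"
      "\<And>a b. coprime a b \<Longrightarrow> 0 \<le> a \<Longrightarrow> 0 \<le> b \<Longrightarrow> \<exists>n. x = int n * a \<and> y = int n * b \<Longrightarrow> g * a + h * b \<le> len a b"
  shows "mtrace x y < mtrace (x + v) (y + w)"
proof -
  obtain n a b where *: "1 \<le> n" "coprime a b" "0 \<le> a" "0 \<le> b" "x = int n * a" "y = int n * b"
  proof -
    have "0 \<le> x" "0 \<le> y" "x \<noteq> 0 \<or> y \<noteq> 0" using assms(1,2) by auto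
    then show thesis using that primitive_multiple[of x y] by blast
  qed
  have "a \<noteq> 0" "b \<noteq> 0" using * assms(1,2) by auto
  then have ab: "1 \<le> a" "1 \<le> b" using *(3,4) by linarith+
  note m = mtrace_mult_bounds[OF *(2-4,1)]
  define t P V where "t = \<sigma> * (a * w - b * v)" and "P = \<sigma> * (e * b - f * a)" and "V = \<sigma> * (e * w - f * v)"
  have "\<sigma> * (x * w - y * v) = n * t" "\<sigma> * (e * y - f * x) = n * P"
    by (simp_all add: * t_def P_def algebra_simps)
  then have tP: "0 < t" "0 < P" "0 \<le> V" using sg * by (simp_all add: zero_less_mult_iff V_def)
  obtain p q p' q' :: real where s: "supports p q" "supports p' q'"
    "p * a + q * b = len a b" "p' * a + q' * b = len a b"
    "\<forall>(x :: real) (y :: real). (p * x + q * y) - (p' * x + q' * y) = 2 * \<sigma> * (a * y - b * x) * lcoth a b"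
  proof -
    obtain p q p' q' :: real where s: "supports p q" "supports p' q'"
      "p * a + q * b = len a b" "p' * a + q' * b = len a b"
      "\<forall>(x :: real) (y :: real). (p * x + q * y) - (p' * x + q' * y) = 2 * (a * y - b * x) * lcoth a b"
      using supports_exist[OF *(2) ab] .
    show thesis
    proof (cases "\<sigma> = 1")
      case True
      then show ?thesis using s that[of p q p' q'] by simp
    next
      case False
      then have "\<sigma> = - 1" using sg by simp
      moreover have "(p' * x + q' * y) - (p * x + q * y) = - 2 * (a * y - b * x) * lcoth a b" for x y :: real
        using s(5)[rule_format, of x y] by linarith
      ultimately show ?thesis using s that[of p' q' p q] by simp
    qed
  qed
  have dif: "(p * v + q * w) - (p' * v + q' * w) = 2 * t * lcoth a b"
    using s(5)[rule_format, of v w] by (simp add: t_def)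
  have pn: "p * x + q * y = n * len a b"
    unfolding s(3)[symmetric] by (simp add: * algebra_simps)
  have plus: "n * len a b + (p * v + q * w) \<le> ln (mtrace (x + v) (y + w))"
    using supports_lnD[OF s(1) assms(3-5)] pn by (simp add: algebra_simps)
  have "0 \<le> P * (p' * v + q' * w)"
  proof -
    \<comment> \<open>Cramer's rule: up to the factor P > 0, (v,w) is V (a,b) - t (e,f) with V >= 0
      and t > 0.\<close>
    have id: "P * v = V * a - t * e" "P * w = V * b - t * f"
      unfolding P_def V_def t_def by (simp_all add: algebra_simps)
    have idr: "real_of_int P * v = V * a - t * e" "real_of_int P * w = V * b - t * f"
      by (simp_all flip: of_int_mult of_int_diff add: id)
    have lin: "P * (k * v + l * w) = V * (k * a + l * b) - t * (k * e + l * f)" for k l :: real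
    proof -
      have "P * (k * v + l * w) = k * (P * v) + l * (P * w)" by (simp add: algebra_simps)
      also have "\<dots> = V * (k * a + l * b) - t * (k * e + l * f)" unfolding id by (simp add: algebra_simps)
      finally show ?thesis .
    qed
    \<comment> \<open>(g,h) attains the length at (e,f) and (p',q') attains it at (a,b), while each
      is at most the length at the other point. Replacing one by the other raises both
      terms.\<close>
    have "0 \<le> P * (g * v + h * w)" using h tP by simp
    also have "\<dots> = V * (g * a + h * b) - t * len e f" unfolding lin h(1) ..
    also have "\<dots> \<le> V * len a b - t * (p' * e + q' * f)"
    proof (intro diff_mono mult_left_mono)
      show "g * a + h * b \<le> len a b" using h(3)[of a b] * by blast
      show "p' * e + q' * f \<le> len e f" using s(2) ef by (simp add: supports_def)
    qed (use tP in auto)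
    also have "\<dots> = P * (p' * v + q' * w)" unfolding lin s(4) ..
    finally show ?thesis .
  qed
  then have "0 \<le> p' * v + q' * w" using tP by (simp add: zero_le_mult_iff)
  moreover have "1 * lcoth a b \<le> t * lcoth a b" using m(4) tP by (intro mult_right_mono) auto
  ultimately have "n * len a b + lcoth a b \<le> ln (mtrace (x + v) (y + w))"
    using dif plus m(4) by linarith
  then have "ln (mtrace x y) < ln (mtrace (x + v) (y + w))" using m(2) by (simp add: *)
  then show ?thesis using mtrace_pos[of x y] mtrace_pos[OF assms(3-5)] assms(1,2) by simp
qed


section \<open>The two boundary directions of the cone\<close>

lemma len_eqI:
  assumes "mtrace a b = r + 1 / r" "1 \<le> r"
  shows "len a b = ln r"
proof -
  have "cosh (ln r) = mtrace a b / 2"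
    using assms by (simp add: cosh_field_def exp_minus inverse_eq_divide)
  then have "len a b = arcosh (cosh (ln r))" by (simp only: len_def)
  also have "\<dots> = ln r" using assms by (intro arcosh_cosh_real) simp
  finally show ?thesis .
qed

text \<open>\<open>(x, y) \<mapsto> alpha0 x + beta0 y\<close> is the functional supporting the norm at \<open>(1, 0)\<close>, and
  \<open>(x, y) \<mapsto> alpha1 x + beta1 y\<close> the one at \<open>(1, 1)\<close> on the side of \<open>(1, 0)\<close>.\<close>

definition "alpha0 = 2 * ln ((1 + sqrt 5) / 2)"
definition "beta0 = ln (3 * (1 + sqrt 5) / (2 * sqrt 5))"
definition "alpha1 = ln (3 * (2 + sqrt 2) / 4)"
definition "beta1 = ln (2 * (2 + sqrt 2) / 3)"

lemma farey_pair_base: "farey_pair 1 0 0 1" "farey_pair 1 1 1 0" by (simp_all add: farey_pair_def)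

text \<open>The squared golden ratio r satisfies r + 1/r = 3 and r - 1/r = sqrt 5;
  \<open>beta0\<close> comes from the traces 3 at (0,1) and 6 at (1,1).\<close>

lemma len_axis: "len 1 0 = alpha0" and lead_axis: "ln (lead 1 0 0 1) = beta0"
proof -
  define r :: real where "r = ((1 + sqrt 5) / 2)\<^sup>2"
  have s: "sqrt 5 * sqrt 5 = (5::real)" by simp
  have r: "r = (3 + sqrt 5) / 2" using s unfolding r_def by (simp add: power2_eq_square field_simps)
  have "(3 - sqrt 5) / 2 * r = 1" "0 < r" unfolding r by (simp_all add: algebra_simps add_pos_nonneg)
  then have ir: "1 / r = (3 - sqrt 5) / 2" by (simp add: divide_eq_eq)
  have "1 \<le> r" by (simp add: r)
  moreover have "mtrace 1 0 = r + 1 / r" unfolding ir by (simp add: mtrace_base r flip: add_divide_distrib)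
  ultimately have l: "len 1 0 = ln r" by (intro len_eqI)
  also have "\<dots> = alpha0" unfolding r_def alpha0_def by (simp add: ln_realpow add_pos_nonneg)
  finally show "len 1 0 = alpha0" .
  have e: "exp (len 1 0) = r" "exp (- len 1 0) = 1 / r"
    using \<open>1 \<le> r\<close> by (simp_all add: l exp_minus inverse_eq_divide)
  have "lead 1 0 0 1 = (6 - (3 - sqrt 5) / 2 * 3) / sqrt 5"
    unfolding lead_def e ir by (simp add: mtrace_base r flip: diff_divide_distrib)
  also have "\<dots> = 3 * (1 + sqrt 5) / (2 * sqrt 5)" by (simp add: field_simps)
  finally show "ln (lead 1 0 0 1) = beta0" by (simp add: beta0_def)
qed

text \<open>r = 3 + 2 sqrt 2 satisfies r + 1/r = 6 and r - 1/r = 4 sqrt 2; \<open>alpha1\<close>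
  comes from the traces 3 at (1,0) and 15 at (2,1), and \<open>beta1\<close> is the rest of ln
  r.\<close>

lemma len_diag: "len 1 1 = alpha1 + beta1" and lead_diag: "ln (lead 1 1 1 0) = alpha1"
proof -
  define r :: real where "r = 3 + 2 * sqrt 2"
  have s: "sqrt 2 * sqrt 2 = (2::real)" by simp
  have "(3 - 2 * sqrt 2) * r = 1" "0 < r" unfolding r_def by (simp_all add: algebra_simps add_pos_nonneg)
  then have ir: "1 / r = 3 - 2 * sqrt 2" by (simp add: divide_eq_eq)
  have "1 \<le> r" by (simp add: r_def)
  moreover have "mtrace 1 1 = r + 1 / r" unfolding ir by (simp add: mtrace_base r_def)
  ultimately have l: "len 1 1 = ln r" by (intro len_eqI)
  also have "r = (3 * (2 + sqrt 2) / 4) * (2 * (2 + sqrt 2) / 3)" unfolding r_def using s by (simp add: field_simps)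
  also have "ln \<dots> = alpha1 + beta1" unfolding alpha1_def beta1_def
    by (rule ln_mult_pos) (simp_all add: add_pos_pos)
  finally show "len 1 1 = alpha1 + beta1" .
  have e: "exp (len 1 1) = r" "exp (- len 1 1) = 1 / r"
    using \<open>1 \<le> r\<close> by (simp_all add: l exp_minus inverse_eq_divide)
  have "mtrace (1 + 1) (1 + 0) = 15"
    using mtrace_add[OF farey_pair_base(2)] by (simp add: mtrace_base)
  then have "lead 1 1 1 0 = (15 - (3 - 2 * sqrt 2) * 3) / (4 * sqrt 2)"
    unfolding lead_def e ir by (simp add: mtrace_base r_def)
  also have "\<dots> = 3 * (2 + sqrt 2) / 4" using s by (simp add: field_simps)
  finally show "ln (lead 1 1 1 0) = alpha1" by (simp only: alpha1_def)
qed

lemma constants_pos: "0 < alpha0" "0 < beta0" "0 < beta1" "0 < alpha1"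
proof -
  have "1 < sqrt (2::real)" "2 < sqrt (5::real)" by (simp_all add: real_less_rsqrt)
  then show "0 < alpha0" "0 < beta0" "0 < beta1" "0 < alpha1"
    unfolding alpha0_def beta0_def alpha1_def beta1_def by (auto intro!: ln_gt_zero mult_pos_pos add_pos_pos simp: field_simps)
qed

lemma axis_support:
  assumes "coprime x y" "0 \<le> x" "0 \<le> y"
  shows "alpha0 * x + beta0 * y \<le> len x y"
proof (cases "y = 0")
  case True
  then have "x = 1" using assms by simp
  with True show ?thesis by (simp add: len_axis)
next
  case False
  then show ?thesis using support_ineq[OF farey_pair_base(1) assms(2,3,1), of x y] assms
    by (simp add: len_axis lead_axis mult.commute)
qed

lemma diag_support:
  assumes "coprime x y" "0 \<le> y" "y \<le> x"
  shows "alpha1 * x + beta1 * y \<le> len x y"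
proof (cases "x = y")
  case True
  then have "x = 1" using assms by simp
  with True show ?thesis by (simp add: len_diag)
next
  case False
  have "0 \<le> x" using assms by simp
  have "y * (alpha1 + beta1) + (x - y) * alpha1 \<le> len x y"
    using support_ineq[OF farey_pair_base(2) \<open>0 \<le> x\<close> assms(2,1), of y "x - y"] False assms(3)
    by (simp add: len_diag lead_diag)
  then show ?thesis by (simp add: algebra_simps)
qed

section \<open>Single steps beyond the critical slopes\<close>

lemma axis_ln:
  assumes "0 < y" "y < (x :: int)"
  shows "alpha0 * x + beta0 * y \<le> ln (mtrace x y)"
  using linear_le_ln_mtrace[of x y alpha0 beta0] axis_support assms by simp

lemma diag_ln:
  assumes "0 < y" "y < (x :: int)"
  shows "alpha1 * x + beta1 * y \<le> ln (mtrace x y)"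
proof (rule linear_le_ln_mtrace)
  fix a b :: int
  assume *: "coprime a b" "0 \<le> a" "0 \<le> b" "\<exists>n. x = int n * a \<and> y = int n * b"
  then obtain n where "x = int n * a" "y = int n * b" by blast
  then have "b \<le> a" using assms mult_less_cancel_left_pos[of "int n" b a] by (cases "n = 0") auto
  with * show "alpha1 * a + beta1 * b \<le> len a b" by (intro diag_support)
qed (use assms in auto)

text \<open>A step turning away from the axis has w > 0, so the axis functional is positive on it. A
  radial step raises a sinh. A step turning towards the axis has w < v and is controlled by the
  diagonal functional.\<close>

lemma mtrace_step_increase:
  assumes "0 < y" "y < x" "0 < y + w" "y + w < x + v" "0 < v" "0 \<le> alpha1 * v + beta1 * w"
  shows "mtrace x y \<le> mtrace (x + v) (y + w)"
proof -
  consider "0 < x * w - y * v" | "x * w - y * v = 0" | "x * w - y * v < 0" by linarith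
  then show ?thesis
  proof cases
    case 1
    have "0 < y * v" using assms by simp
    then have "0 < x * w" using 1 by linarith
    then have w: "0 < w" using assms by (simp add: zero_less_mult_iff)
    have "mtrace x y < mtrace (x + v) (y + w)"
    proof (rule mtrace_mono[where e = 1 and f = 0 and \<sigma> = 1 and g = alpha0 and h = beta0])
      show "0 \<le> alpha0 * v + beta0 * w" using constants_pos w assms by simp
    qed (use assms 1 w axis_support in \<open>auto simp: len_axis\<close>)
    then show ?thesis by simp
  next
    case 2
    obtain n a b where *: "1 \<le> n" "coprime a b" "0 \<le> a" "0 \<le> b" "x = int n * a" "y = int n * b"
    proof -
      have "0 \<le> x" "0 \<le> y" "x \<noteq> 0 \<or> y \<noteq> 0" using assms by auto
      then show thesis using that primitive_multiple[of x y] by blast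
    qed
    have "int n * (a * w) = int n * (b * v)" using 2 * by (simp add: algebra_simps)
    then have aw: "a * w = b * v" using *(1) by simp
    then have "a dvd b * v" by (metis dvd_triv_left)
    then have "a dvd v" using *(2) by (simp add: coprime_dvd_mult_right_iff)
    then obtain k where k: "v = a * k" ..
    have a: "0 < a" using * assms by (metis less_le_trans mult_zero_right not_less order.strict_trans order_le_less)
    then have w: "w = b * k" using aw k by simp
    have "0 < k" using k a assms by (simp add: zero_less_mult_iff)
    then have eq: "x + v = int (n + nat k) * a" "y + w = int (n + nat k) * b"
      using * k w by (simp_all add: algebra_simps)
    define L where "L = len a b"
    have L: "0 < L" "0 < exp L - exp (- L)" using coprime_len[OF *(2-4)] by (simp_all add: L_def)
    have nL: "n * L \<le> (n + nat k) * L" using L by (intro mult_right_mono) auto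
    have "0 \<le> (exp L + exp (- L)) / (exp L - exp (- L))" using L by (simp add: add_nonneg_nonneg)
    then have "(exp L + exp (- L)) / (exp L - exp (- L)) * (exp (n * L) - exp (- (n * L)))
      \<le> (exp L + exp (- L)) / (exp L - exp (- L)) * (exp ((n + nat k) * L) - exp (- ((n + nat k) * L)))"
      using nL by (intro mult_left_mono diff_mono) auto
    then show ?thesis unfolding eq unfolding * mtrace_mult[OF *(2-4)] by (simp add: L_def)
  next
    case 3
    have "y * v < x * v" using assms by simp
    then have "x * w < x * v" using 3 by linarith
    then have w: "w < v" using assms by simp
    have "mtrace x y < mtrace (x + v) (y + w)"
    proof (rule mtrace_mono[where e = 1 and f = 1 and \<sigma> = "-1" and g = alpha1 and h = beta1])
      fix a b :: int
      assume *: "coprime a b" "0 \<le> a" "0 \<le> b" "\<exists>n. x = int n * a \<and> y = int n * b"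
      then obtain n where "x = int n * a" "y = int n * b" by blast
      then have "b \<le> a" using assms mult_less_cancel_left_pos[of "int n" b a] by (cases "n = 0") auto
      with * show "alpha1 * a + beta1 * b \<le> len a b" by (intro diag_support)
    qed (use assms 3 w in \<open>auto simp: len_diag\<close>)
    then show ?thesis by simp
  qed
qed

text \<open>Here w < 0, so the reversed step, taken from the endpoint, turns away from the axis and
  the axis functional is nonnegative on it.\<close>

lemma mtrace_step_decrease:
  assumes "0 < y" "y < x" "0 < y + w" "y + w < x + v" "0 < v" "alpha0 * v + beta0 * w \<le> 0"
  shows "mtrace (x + v) (y + w) \<le> mtrace x y"
proof -
  have "0 < alpha0 * v" using constants_pos assms by simp
  then have "beta0 * w < 0" using assms(6) by linarith
  then have w: "w < 0" using constants_pos by (simp add: mult_less_0_iff)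
  have "0 \<le> (y + w) * v" "(x + v) * w < 0" using assms w by (simp_all add: mult_pos_neg)
  then have det: "0 < (x + v) * (- w) - (y + w) * (- v)"
    unfolding mult_minus_right by linarith
  have "mtrace (x + v) (y + w) < mtrace ((x + v) + - v) ((y + w) + - w)"
  proof (rule mtrace_mono[where e = 1 and f = 0 and \<sigma> = 1 and g = alpha0 and h = beta0])
    show "0 < 1 * ((x + v) * (- w) - (y + w) * (- v))" using det by simp
    show "0 \<le> alpha0 * real_of_int (- v) + beta0 * real_of_int (- w)" using assms(6) by simp
  qed (use assms w axis_support in \<open>auto simp: len_axis\<close>)
  then show ?thesis by simp
qed

section \<open>Upper bounds near the boundary rays\<close>

lemma mtrace_upper:
  assumes "farey_pair a b c d" "0 < r + s"
  shows "mtrace (int r * a + int s * c) (int r * b + int s * d) \<le> mtrace a b ^ r * mtrace c d ^ s"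
  using assms
proof (induction "r + s" arbitrary: a b c d r s rule: less_induct)
  case less
  have mult: "mtrace (int n * x) (int n * y) \<le> mtrace x y ^ n" if xy: "coprime x y" "0 \<le> x" "0 \<le> y" and "0 < n" for n x y
    using that(4)
  proof (induction n rule: induct_nat_012)
    case (ge2 n)
    have "0 \<le> mtrace (int n * x) (int n * y)"
      using mtrace_mult_bounds(1)[OF xy, of n] by (cases "n = 0") (auto simp: mtrace_def gen_markov_def)
    then have "mtrace (int (Suc (Suc n)) * x) (int (Suc (Suc n)) * y)
        \<le> mtrace x y * mtrace (int (Suc n) * x) (int (Suc n) * y)"
      unfolding mtrace_mult_Suc[OF xy] by simp
    also have "\<dots> \<le> mtrace x y * mtrace x y ^ Suc n"
      using ge2 coprime_len(4)[OF xy] by (intro mult_left_mono) auto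
    finally show ?case by simp
  qed simp_all
  note nb = less.prems(1)
  have nn: "0 \<le> a" "0 \<le> b" "0 \<le> c" "0 \<le> d" using nb by (simp_all add: farey_pair_def)
  have ge: "3 \<le> mtrace a b" "3 \<le> mtrace c d" using mtrace_triple[OF nb] by simp_all
  have pos: "0 \<le> mtrace (a + c) (b + d)" using mtrace_triple[OF nb] by simp
  \<comment> \<open>Subtractive Euclid on (r,s): one copy of each vector is merged into the sum
    vector as often as possible, and \<open>mtrace_add_le\<close> bounds the trace of that
    sum.\<close>
  consider "s = 0" | "r = 0" | "0 < s" "s \<le> r" | "0 < r" "r \<le> s" by linarith
  then show ?case
  proof cases
    case 1
    then show ?thesis using mult[OF farey_pair_coprime(1)[OF nb], of r] nn less.prems by simp
  next
    case 2
    then show ?thesis using mult[OF farey_pair_coprime(2)[OF nb], of s] nn less.prems by simp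
  next
    case 3
    have "mtrace (int (r - s) * a + int s * (a + c)) (int (r - s) * b + int s * (b + d))
      \<le> mtrace a b ^ (r - s) * mtrace (a + c) (b + d) ^ s"
      using 3 by (intro less.hyps farey_pair_add[OF nb]) auto
    also have "\<dots> \<le> mtrace a b ^ (r - s) * (mtrace a b * mtrace c d) ^ s"
      using mtrace_add_le[OF nb] ge pos by (intro mult_left_mono power_mono) auto
    also have "\<dots> = (mtrace a b ^ (r - s) * mtrace a b ^ s) * mtrace c d ^ s" by (simp add: power_mult_distrib)
    also have "mtrace a b ^ (r - s) * mtrace a b ^ s = mtrace a b ^ r" using 3 by (simp flip: power_add)
    finally show ?thesis using 3 by (simp add: of_nat_diff algebra_simps)
  next
    case 4
    have "mtrace (int (s - r) * c + int r * (c + a)) (int (s - r) * d + int r * (d + b))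
      \<le> mtrace c d ^ (s - r) * mtrace (c + a) (d + b) ^ r"
      using 4 by (intro less.hyps farey_pair_add[OF farey_pair_commute[OF nb]]) auto
    also have "\<dots> \<le> mtrace c d ^ (s - r) * (mtrace c d * mtrace a b) ^ r"
      using mtrace_add_le[OF farey_pair_commute[OF nb]] ge pos by (intro mult_left_mono power_mono) (auto simp: add.commute)
    also have "\<dots> = (mtrace c d ^ (s - r) * mtrace c d ^ r) * mtrace a b ^ r" by (simp add: power_mult_distrib)
    also have "mtrace c d ^ (s - r) * mtrace c d ^ r = mtrace c d ^ s" using 4 by (simp flip: power_add)
    finally show ?thesis using 4 by (simp add: of_nat_diff algebra_simps)
  qed
qed

lemma ln_mtrace_seq_le:
  fixes n m :: nat
  assumes "farey_pair a b c d" "n \<le> m"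
  shows "ln (mtrace (c + int m * a) (d + int m * b))
    \<le> m * len a b + ln (lead a b c d) + trail a b c d / lead a b c d * exp (- 2 * n * len a b)"
proof -
  note lt = lead_trail(4,5)[OF assms(1)]
  define L p q where "L = len a b" and "p = lead a b c d" and "q = trail a b c d"
  have L: "0 < L" and pq: "0 < p" "0 < q" using farey_pair_len(1)[OF assms(1)] lt by (simp_all add: L_def p_def q_def)
  have "mtrace (c + int m * a) (d + int m * b) = p * exp (m * L) + q * exp (- (m * L))"
    using lead_trail(1)[OF farey_pair_add_mult[OF assms(1), of m]] lead_add_mult[OF assms(1), of m]
    by (simp add: L_def p_def q_def)
  also have "\<dots> = p * exp (m * L) * (1 + q / p * exp (- 2 * m * L))"
    using pq by (simp add: field_simps flip: exp_add)
  finally have "ln (mtrace (c + int m * a) (d + int m * b)) = ln (p * exp (m * L) * (1 + q / p * exp (- 2 * m * L)))"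
    by simp
  also have "\<dots> = ln p + m * L + ln (1 + q / p * exp (- 2 * m * L))"
  proof -
    have "0 < 1 + q / p * exp (- 2 * m * L)" using pq by (intro add_pos_nonneg) auto
    then show ?thesis using pq by (simp add: ln_mult)
  qed
  also have "ln (1 + q / p * exp (- 2 * m * L)) \<le> q / p * exp (- 2 * m * L)"
    using pq by (intro ln_add_one_self_le_self) simp
  also have "\<dots> \<le> q / p * exp (- 2 * n * L)"
    using pq L assms(2) by (intro mult_left_mono) auto
  finally show ?thesis by (simp add: L_def p_def q_def)
qed

text \<open>Applying \<open>mtrace_upper\<close> to r copies of (a,b) would cost ln (1 + e^(-2L))
  per copy, an error growing with r. Instead the copies are spread over s neighbours (c,d) + m (a,b)
  and (c,d) + (m+1) (a,b), where m = r div s; only s summands remain, each with an exponentially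
  small error.\<close>

lemma ln_mtrace_le:
  fixes n r s :: nat
  assumes "farey_pair a b c d" "1 \<le> s" "n * s \<le> r"
  shows "ln (mtrace (int r * a + int s * c) (int r * b + int s * d))
    \<le> r * len a b + s * ln (lead a b c d) + s * (trail a b c d / lead a b c d * exp (- 2 * n * len a b))"
proof -
  define m k where "m = r div s" and "k = r mod s"
  have r: "r = m * s + k" "k < s" using assms by (simp_all add: m_def k_def)
  have nm: "n \<le> m" using div_le_mono[OF assms(3), of s] assms(2) by (simp add: m_def)
  define E where "E = trail a b c d / lead a b c d * exp (- 2 * n * len a b)"
  define c0 d0 c1 d1 where "c0 = c + int m * a" "d0 = d + int m * b"
    "c1 = c + int (Suc m) * a" "d1 = d + int (Suc m) * b"
  note defs = this
  have b0: "ln (mtrace c0 d0) \<le> m * len a b + ln (lead a b c d) + E"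
    using ln_mtrace_seq_le[OF assms(1) nm] by (simp only: defs E_def)
  have b1: "ln (mtrace c1 d1) \<le> Suc m * len a b + ln (lead a b c d) + E"
    using ln_mtrace_seq_le[OF assms(1), of n "Suc m"] nm by (simp only: defs E_def)
  have nb0: "farey_pair a b c0 d0" "farey_pair a b c1 d1" unfolding defs by (intro farey_pair_add_mult assms)+
  have nb: "farey_pair c0 d0 c1 d1" using assms(1) unfolding defs farey_pair_def by (simp add: algebra_simps abs_minus_commute)
  have pos: "3 \<le> mtrace c0 d0" "3 \<le> mtrace c1 d1" using mtrace_triple[OF nb] by simp_all
  have X: "int r * a + int s * c = int (s - k) * c0 + int k * c1"
    "int r * b + int s * d = int (s - k) * d0 + int k * d1"
    using r by (simp_all add: defs of_nat_diff algebra_simps)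
  have n0: "0 \<le> c0" "0 \<le> d0" "0 \<le> c1" "0 \<le> d1" using nb by (simp_all add: farey_pair_def)
  have "0 < mtrace (int r * a + int s * c) (int r * b + int s * d)"
  proof (rule mtrace_pos)
    have "1 \<le> c0 + d0" using farey_pair_sum_pos[OF nb] by simp
    then have "1 * 1 \<le> int (s - k) * (c0 + d0)" using r by (intro mult_mono) auto
    moreover have "0 \<le> int k * (c1 + d1)" using n0 by simp
    ultimately show "int r * a + int s * c \<noteq> 0 \<or> int r * b + int s * d \<noteq> 0"
      unfolding X distrib_left by linarith
  qed (use assms farey_pair_nonneg[OF assms(1)] in auto)
  moreover have "mtrace (int r * a + int s * c) (int r * b + int s * d) \<le> mtrace c0 d0 ^ (s - k) * mtrace c1 d1 ^ k"
    unfolding X using r by (intro mtrace_upper nb) simp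
  ultimately have "ln (mtrace (int r * a + int s * c) (int r * b + int s * d)) \<le> ln (mtrace c0 d0 ^ (s - k) * mtrace c1 d1 ^ k)"
    using pos by simp
  also have "\<dots> = real (s - k) * ln (mtrace c0 d0) + k * ln (mtrace c1 d1)"
    using pos by (simp add: ln_mult ln_realpow)
  also have "\<dots> \<le> real (s - k) * (m * len a b + ln (lead a b c d) + E) + k * (Suc m * len a b + ln (lead a b c d) + E)"
    using b0 b1 by (intro add_mono mult_left_mono) auto
  also have "\<dots> = r * len a b + s * ln (lead a b c d) + s * E"
    using r by (simp add: of_nat_diff algebra_simps)
  finally show ?thesis by (simp add: E_def)
qed

text \<open>At most S neighbours are involved, so their total error tends to 0 as r grows and drops
  below any fixed gap.\<close>

lemma strict_step:
  fixes S :: nat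
  assumes "farey_pair a b c d" "0 < \<epsilon>"
  shows "\<exists>N :: nat. \<forall>(r :: nat) (s :: nat) z. N \<le> r \<longrightarrow> 1 \<le> s \<longrightarrow> s \<le> S \<longrightarrow> 0 < z \<longrightarrow>
    r * len a b + s * ln (lead a b c d) + \<epsilon> \<le> ln z \<longrightarrow> mtrace (int r * a + int s * c) (int r * b + int s * d) < z"
proof -
  note lt = lead_trail(4,5)[OF assms(1)]
  define Q where "Q = S * (trail a b c d / lead a b c d)"
  have Q: "0 \<le> Q" using lt by (simp add: Q_def)
  have "(\<lambda>n. Q * exp (- 2 * len a b) ^ n) \<longlonglongrightarrow> Q * 0"
    using farey_pair_len(1)[OF assms(1)] by (intro tendsto_mult tendsto_const LIMSEQ_realpow_zero) auto
  then have "\<forall>\<^sub>F n in sequentially. Q * exp (- 2 * len a b) ^ n < \<epsilon>"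
    using assms(2) by (intro order_tendstoD) auto
  then obtain n where "Q * exp (- 2 * len a b) ^ n < \<epsilon>" by (auto simp: eventually_sequentially)
  then have n: "Q * exp (- 2 * n * len a b) < \<epsilon>" by (simp add: mult_ac flip: exp_of_nat_mult)
  show ?thesis
  \<comment> \<open>The threshold n S gives n s <= r for every s <= S, as
    \<open>ln_mtrace_le\<close> requires.\<close>
  proof (intro exI[of _ "n * S"] allI impI)
    fix r s :: nat and z assume *: "n * S \<le> r" "1 \<le> s" "s \<le> S" "0 < z"
      "r * len a b + s * ln (lead a b c d) + \<epsilon> \<le> ln z"
    have "n * s \<le> r" using *(1,3) by (meson mult_le_mono2 order_trans)
    from ln_mtrace_le[OF assms(1) *(2) this]
    have "ln (mtrace (int r * a + int s * c) (int r * b + int s * d))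
      \<le> r * len a b + s * ln (lead a b c d) + s * (trail a b c d / lead a b c d * exp (- 2 * n * len a b))" .
    also have "s * (trail a b c d / lead a b c d * exp (- 2 * n * len a b)) \<le> S * (trail a b c d / lead a b c d * exp (- 2 * n * len a b))"
      using lt *(3) by (intro mult_right_mono) auto
    also have "\<dots> = Q * exp (- 2 * n * len a b)" by (simp add: Q_def)
    also have "\<dots> < \<epsilon>" by (rule n)
    finally have "ln (mtrace (int r * a + int s * c) (int r * b + int s * d)) < ln z" using * by simp
    moreover have "0 < mtrace (int r * a + int s * c) (int r * b + int s * d)"
    proof (rule mtrace_pos)
      have "1 * 1 \<le> int s * (c + d)" using *(2) farey_pair_sum_pos[OF assms(1)] by (intro mult_mono) auto
      moreover have "0 \<le> int r * (a + b)" using farey_pair_nonneg[OF assms(1)] by simp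
      ultimately show "int r * a + int s * c \<noteq> 0 \<or> int r * b + int s * d \<noteq> 0" by (auto simp: distrib_left)
    qed (use farey_pair_nonneg[OF assms(1)] in auto)
    ultimately show "mtrace (int r * a + int s * c) (int r * b + int s * d) < z" using *(4) by simp
  qed
qed

text \<open>The sharp upper bound holds at (x,y), the bound \<open>axis_ln\<close> at the next
  point, and the functional grows by a fixed positive amount over the step. Bounded height keeps the
  number of neighbours bounded.\<close>

lemma increase_near_axis:
  fixes v w S :: int
  assumes "0 < alpha0 * v + beta0 * w"
  shows "\<exists>B. \<forall>x y. B \<le> x \<longrightarrow> 0 < y \<longrightarrow> y < x \<longrightarrow> y \<le> S \<longrightarrow> 0 < y + w \<longrightarrow> y + w < x + v \<longrightarrow>
    mtrace x y < mtrace (x + v) (y + w)"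
proof -
  obtain N :: nat where N: "\<And>(r :: nat) (s :: nat) z. N \<le> r \<longrightarrow> 1 \<le> s \<longrightarrow> s \<le> nat S \<longrightarrow> 0 < z \<longrightarrow>
    r * alpha0 + s * beta0 + (alpha0 * v + beta0 * w) \<le> ln z \<longrightarrow> mtrace (int r * 1 + int s * 0) (int r * 0 + int s * 1) < z"
    using strict_step[OF farey_pair_base(1) assms, of "nat S", unfolded len_axis lead_axis] by blast
  show ?thesis
  proof (intro exI[of _ "int N"] allI impI)
    fix x y assume *: "int N \<le> x" "0 < y" "y < x" "y \<le> S" "0 < y + w" "y + w < x + v"
    have "mtrace (int (nat x) * 1 + int (nat y) * 0) (int (nat x) * 0 + int (nat y) * 1) < mtrace (x + v) (y + w)"
    proof (rule N[rule_format])
      show "0 < mtrace (x + v) (y + w)" using * by (intro mtrace_pos) auto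
      show "nat x * alpha0 + nat y * beta0 + (alpha0 * v + beta0 * w) \<le> ln (mtrace (x + v) (y + w))"
        using axis_ln[OF *(5,6)] * by (simp add: algebra_simps)
    qed (use * in auto)
    then show "mtrace x y < mtrace (x + v) (y + w)" using * by simp
  qed
qed

text \<open>Now the sharp upper bound is used at the endpoint and \<open>diag_ln\<close> at the
  starting point; the bounded quantity is the difference of the endpoint's coordinates.\<close>

lemma decrease_near_diag:
  fixes v w S :: int
  assumes "alpha1 * v + beta1 * w < 0"
  shows "\<exists>B. \<forall>x y. B \<le> y + w \<longrightarrow> 0 < y \<longrightarrow> y < x \<longrightarrow> (x + v) - (y + w) \<le> S \<longrightarrow> 0 < y + w \<longrightarrow> y + w < x + v \<longrightarrow>
    mtrace (x + v) (y + w) < mtrace x y"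
proof -
  have "0 < - (alpha1 * v + beta1 * w)" using assms by simp
  then obtain N :: nat where N: "\<And>(r :: nat) (s :: nat) z. N \<le> r \<longrightarrow> 1 \<le> s \<longrightarrow> s \<le> nat S \<longrightarrow> 0 < z \<longrightarrow>
    r * (alpha1 + beta1) + s * alpha1 + - (alpha1 * v + beta1 * w) \<le> ln z \<longrightarrow> mtrace (int r * 1 + int s * 1) (int r * 1 + int s * 0) < z"
    using strict_step[OF farey_pair_base(2), of "- (alpha1 * v + beta1 * w)" "nat S", unfolded len_diag lead_diag] by blast
  show ?thesis
  proof (intro exI[of _ "int N"] allI impI)
    fix x y assume *: "int N \<le> y + w" "0 < y" "y < x" "(x + v) - (y + w) \<le> S" "0 < y + w" "y + w < x + v"
    have "mtrace (int (nat (y + w)) * 1 + int (nat (x + v - (y + w))) * 1) (int (nat (y + w)) * 1 + int (nat (x + v - (y + w))) * 0)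
      < mtrace x y"
    proof (rule N[rule_format])
      show "0 < mtrace x y" using * by (intro mtrace_pos) auto
      show "nat (y + w) * (alpha1 + beta1) + nat (x + v - (y + w)) * alpha1 + - (alpha1 * v + beta1 * w) \<le> ln (mtrace x y)"
        using diag_ln[OF *(2,3)] * by (simp add: algebra_simps)
    qed (use * in auto)
    then show "mtrace (x + v) (y + w) < mtrace x y" using * by simp
  qed
qed


section \<open>Lines\<close>

lemma line_pts_iff:
  assumes "0 < y" "y < (x :: int)"
  shows "(nat x, nat y) \<in> line_pts k b \<longleftrightarrow> real_of_int y = k * x + b"
  using assms by (auto simp: line_pts_def D_def)

lemma line_ptsD:
  assumes "(x, y) \<in> line_pts k b"
  shows "0 < int y" "int y < int x" "real y = k * x + b"
  using assms by (auto simp: line_pts_def D_def)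

lemma inj_on_fst_line_pts: "inj_on fst (line_pts k b)"
proof (rule inj_onI)
  fix s t assume st: "s \<in> line_pts k b" "t \<in> line_pts k b" "fst s = fst t"
  obtain x y z where "s = (x, y)" "t = (x, z)" using st(3) by (metis prod.collapse)
  then show "s = t" using st line_ptsD(3)[of x y k b] line_ptsD(3)[of x z k b] by simp
qed

lemma has_pt_iff: "has_pt k b i \<longleftrightarrow> infinite (fst ` line_pts k b) \<or> i < card (fst ` line_pts k b)"
  unfolding has_pt_def by (simp add: card_image inj_on_fst_line_pts finite_image_iff)

lemma has_pt_less: "has_pt k b j \<Longrightarrow> i \<le> j \<Longrightarrow> has_pt k b i"
  unfolding has_pt_def by auto

lemma pt_in_line:
  assumes "has_pt k b i"
  shows "(pt_x k b i, pt_y k b i) \<in> line_pts k b"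
proof -
  have "pt_x k b i \<in> fst ` line_pts k b"
    unfolding pt_x_def using assms enumerate_in_set finite_enumerate_in_set unfolding has_pt_iff by blast
  then obtain y where y: "(pt_x k b i, y) \<in> line_pts k b" by auto
  moreover have "z = y" if "(pt_x k b i, z) \<in> line_pts k b" for z
    using line_ptsD(3)[OF y] line_ptsD(3)[OF that] by simp
  ultimately show ?thesis unfolding pt_y_def by (rule theI)
qed

lemma pt_Suc_Least:
  assumes "has_pt k b (Suc i)"
  shows "pt_x k b (Suc i) = (LEAST s. s \<in> fst ` line_pts k b \<and> pt_x k b i < s)"
  unfolding pt_x_def using assms enumerate_Suc'' finite_enumerate_Suc'' unfolding has_pt_iff by blast

lemma pt_x_less:
  assumes "has_pt k b j" "i < j"
  shows "pt_x k b i < pt_x k b j"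
  unfolding pt_x_def using assms enumerate_mono finite_enumerate_mono unfolding has_pt_iff by blast

lemma pt_exists:
  assumes "(x, y) \<in> line_pts k b"
  obtains i where "has_pt k b i" "pt_x k b i = x" "pt_y k b i = y"
proof -
  have "x \<in> fst ` line_pts k b" using assms by force
  then obtain i where i: "has_pt k b i" "pt_x k b i = x"
    using enumerate_Ex finite_enumerate_Ex unfolding has_pt_iff pt_x_def by metis
  then have "pt_y k b i = y" using line_ptsD(3)[OF assms] line_ptsD(3)[OF pt_in_line[OF i(1)]] by simp
  with i show thesis by (rule that)
qed

section \<open>Lattice points on a line of rational slope\<close>

locale rational_slope =
  fixes k :: real and p q :: int
  assumes q_pos: "0 < q" and coprime_pq: "coprime p q" and slope: "k = real_of_int p / real_of_int q"
begin

lemma line_shift: "real_of_int (y + m * p) = k * real_of_int (x + m * q) + b \<longleftrightarrow> real_of_int y = k * x + b"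
  using q_pos by (simp add: slope field_simps)

lemma line_diff:
  assumes "real_of_int y = k * real_of_int x + b" "real_of_int y' = k * real_of_int x' + b"
  obtains m where "x' = x + m * q" "y' = y + m * p"
proof -
  have "(y' - y) * q = p * (x' - x)"
  proof -
    have "real_of_int (y' - y) = k * real_of_int (x' - x)" using assms by (simp add: algebra_simps)
    then have "real_of_int ((y' - y) * q) = real_of_int (p * (x' - x))" using q_pos by (simp add: slope field_simps)
    then show ?thesis by (simp only: of_int_eq_iff)
  qed
  moreover from this have "q dvd p * (x' - x)" by (metis dvd_triv_right)
  then have "q dvd x' - x" using coprime_pq by (simp add: coprime_commute coprime_dvd_mult_right_iff)
  then obtain m where m: "x' - x = q * m" ..
  ultimately have "y' - y = p * m" using q_pos by simp
  with m show thesis using that[of m] by (simp add: algebra_simps)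
qed

text \<open>No lattice point is skipped: \<open>D\<close> is cut out by two linear inequalities, so
  if (x,y) and (x,y) + m (q,p) lie in it with m >= 1, then so does (x,y) + (q,p).\<close>

lemma pt_Suc:
  assumes "has_pt k b (Suc i)"
  shows "int (pt_x k b (Suc i)) = int (pt_x k b i) + q" "int (pt_y k b (Suc i)) = int (pt_y k b i) + p"
proof -
  define x y x' y' where "x = int (pt_x k b i)" "y = int (pt_y k b i)"
    "x' = int (pt_x k b (Suc i))" "y' = int (pt_y k b (Suc i))"
  note defs = this
  have xy: "0 < y" "y < x" "real_of_int y = k * x + b"
    using line_ptsD[OF pt_in_line[OF has_pt_less[OF assms, of i]]] by (simp_all add: defs)
  have xy': "0 < y'" "y' < x'" "real_of_int y' = k * x' + b"
    using line_ptsD[OF pt_in_line[OF assms]] by (simp_all add: defs)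
  have less: "x < x'" using pt_x_less[OF assms, of i] by (simp add: defs)
  obtain m where m: "x' = x + m * q" "y' = y + m * p" using line_diff[OF xy(3) xy'(3)] .
  have m1: "1 \<le> m" using less q_pos m by (simp add: zero_less_mult_iff)
  have "0 < y + p"
  proof (cases "0 \<le> p")
    case False
    then have "m * p \<le> 1 * p" using m1 by (intro mult_right_mono_neg) auto
    then show ?thesis using xy' m by linarith
  qed (use xy in simp)
  moreover have "y + p < x + q"
  proof (cases "0 \<le> q - p")
    case False
    then have "m * (q - p) \<le> 1 * (q - p)" using m1 by (intro mult_right_mono_neg) auto
    then show ?thesis using xy' m by (simp add: algebra_simps)
  qed (use xy in simp)
  ultimately have "(nat (x + q), nat (y + p)) \<in> line_pts k b"
    using line_shift[of y 1 x b] xy by (subst line_pts_iff) auto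
  then have "nat (x + q) \<in> fst ` line_pts k b" by force
  moreover have "pt_x k b i < nat (x + q)" using q_pos by (simp add: defs)
  ultimately have "pt_x k b (Suc i) \<le> nat (x + q)"
    unfolding pt_Suc_Least[OF assms] by (intro Least_le) simp
  then have "x' \<le> x + q" using q_pos xy by (simp add: defs)
  then have "m * q \<le> 1 * q" using m by simp
  then have "m \<le> 1" using q_pos by simp
  then have "m = 1" using m1 by simp
  then show "int (pt_x k b (Suc i)) = int (pt_x k b i) + q" "int (pt_y k b (Suc i)) = int (pt_y k b i) + p"
    using m by (simp_all add: defs)
qed

lemma consecutive_pts:
  assumes "0 < y" "y < x" "0 < y + p" "y + p < x + q" "real_of_int y = k * x + b"
  obtains i where "has_pt k b (Suc i)" "int (pt_x k b i) = x" "int (pt_y k b i) = y"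
proof -
  have "(nat x, nat y) \<in> line_pts k b" using assms by (simp add: line_pts_iff)
  then obtain i where i: "has_pt k b i" "pt_x k b i = nat x" "pt_y k b i = nat y" by (rule pt_exists)
  have "(nat (x + q), nat (y + p)) \<in> line_pts k b"
    using line_shift[of y 1 x b] assms by (subst line_pts_iff) auto
  then obtain j where j: "has_pt k b j" "pt_x k b j = nat (x + q)" by (rule pt_exists)
  have "i < j"
  proof (rule ccontr)
    assume "\<not> i < j"
    then have "j < i \<or> j = i" by linarith
    then have "pt_x k b j \<le> pt_x k b i" using pt_x_less[OF i(1)] by fastforce
    then show False using i j q_pos assms by simp
  qed
  then have "has_pt k b (Suc i)" using has_pt_less[OF j(1)] by simp
  then show thesis using i assms by (intro that) auto
qed

end

section \<open>Ratios along a line\<close>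

definition mtrace_at :: "real \<Rightarrow> real \<Rightarrow> nat \<Rightarrow> real" where
  "mtrace_at k b i = mtrace (int (pt_x k b i)) (int (pt_y k b i))"

lemma mtrace_at_markov: "mtrace_at k b i = 3 * real_of_int (markov_at k b i)"
  by (simp add: mtrace_at_def mtrace_def markov_at_def)

lemma mtrace_at_pos: "has_pt k b i \<Longrightarrow> 0 < mtrace_at k b i"
  unfolding mtrace_at_def using line_ptsD[OF pt_in_line] by (intro mtrace_pos) auto

lemma ratio_mtrace: "ratio k b i = mtrace_at k b (Suc i) / mtrace_at k b i"
  by (simp add: ratio_def mtrace_at_markov)

lemma ratio_le_1: "has_pt k b (Suc i) \<Longrightarrow> ratio k b i \<le> 1 \<longleftrightarrow> mtrace_at k b (Suc i) \<le> mtrace_at k b i"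
  and ratio_ge_1: "has_pt k b (Suc i) \<Longrightarrow> 1 \<le> ratio k b i \<longleftrightarrow> mtrace_at k b i \<le> mtrace_at k b (Suc i)"
  using mtrace_at_pos[OF has_pt_less[of k b "Suc i" i]] by (simp_all add: ratio_mtrace field_simps)

context rational_slope
begin

lemma increasing_if:
  assumes "- (alpha1 / beta1) \<le> k"
  shows "markov_increasing k b"
  unfolding markov_increasing_def
proof (intro allI impI)
  fix i assume i: "has_pt k b (Suc i)"
  note D = line_ptsD[OF pt_in_line[OF has_pt_less[OF i, of i]]] line_ptsD[OF pt_in_line[OF i]]
  have "- alpha1 * q \<le> beta1 * p"
    using assms q_pos constants_pos by (simp add: slope field_simps)
  then have "mtrace_at k b i \<le> mtrace_at k b (Suc i)"
    unfolding mtrace_at_def pt_Suc[OF i]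
    using D q_pos by (intro mtrace_step_increase) (simp_all flip: pt_Suc[OF i])
  then show "1 \<le> ratio k b i" using ratio_ge_1[OF i] by simp
qed

lemma decreasing_if:
  assumes "k \<le> - (alpha0 / beta0)"
  shows "markov_decreasing k b"
  unfolding markov_decreasing_def
proof (intro allI impI)
  fix i assume i: "has_pt k b (Suc i)"
  note D = line_ptsD[OF pt_in_line[OF has_pt_less[OF i, of i]]] line_ptsD[OF pt_in_line[OF i]]
  have "beta0 * p \<le> - alpha0 * q"
    using assms q_pos constants_pos by (simp add: slope field_simps)
  then have "mtrace_at k b (Suc i) \<le> mtrace_at k b i"
    unfolding mtrace_at_def pt_Suc[OF i]
    using D q_pos by (intro mtrace_step_decrease) (simp_all flip: pt_Suc[OF i])
  then show "ratio k b i \<le> 1" using ratio_le_1[OF i] by simp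
qed

lemma ratio_Suc_mono:
  assumes "k < 0" "has_pt k b (Suc (Suc i))"
  shows "ratio k b i \<le> ratio k b (Suc i)"
proof -
  have h1: "has_pt k b (Suc i)" and h0: "has_pt k b i" using has_pt_less[OF assms(2)] by simp_all
  define x y where "x = int (pt_x k b (Suc i))" and "y = int (pt_y k b (Suc i))"
  have nx: "int (pt_x k b (Suc (Suc i))) = x + q" "int (pt_y k b (Suc (Suc i))) = y + p"
    using pt_Suc[OF assms(2)] by (simp_all add: x_def y_def)
  have pr: "int (pt_x k b i) = x - q" "int (pt_y k b i) = y - p"
    using pt_Suc[OF h1] by (simp_all add: x_def y_def)
  have D: "0 < y" "y < x" "0 < y + p" "y + p < x + q" "0 < y - p" "y - p < x - q"
    using line_ptsD[OF pt_in_line[OF h1]] line_ptsD[OF pt_in_line[OF h0]] line_ptsD[OF pt_in_line[OF assms(2)]]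
    unfolding nx pr by (simp_all add: x_def y_def)
  \<comment> \<open>A line of negative slope through the open quadrant misses the origin, so the
    step is not radial and log-convexity applies.\<close>
  have "p < 0" using assms(1) q_pos by (simp add: slope divide_less_0_iff)
  then have "x * p < 0" "0 < y * q" using D q_pos by (simp_all add: mult_pos_neg)
  then have "x * p - y * q \<noteq> 0" by linarith
  then have "(mtrace x y)\<^sup>2 \<le> mtrace (x + q) (y + p) * mtrace (x - q) (y - p)"
    using D by (intro mtrace_log_convex) auto
  then have "(mtrace_at k b (Suc i))\<^sup>2 \<le> mtrace_at k b (Suc (Suc i)) * mtrace_at k b i"
    unfolding mtrace_at_def nx pr by (simp add: x_def y_def)
  then show ?thesis
    using mtrace_at_pos[OF h0] mtrace_at_pos[OF h1] by (simp add: ratio_mtrace power2_eq_square field_simps)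
qed

lemma ratio_mono:
  assumes "k < 0" "i \<le> j" "has_pt k b (Suc j)"
  shows "ratio k b i \<le> ratio k b j"
  using assms(2,3)
proof (induction j rule: dec_induct)
  case (step j)
  then have "ratio k b i \<le> ratio k b j" using has_pt_less[OF step.prems] by simp
  also have "\<dots> \<le> ratio k b (Suc j)" using ratio_Suc_mono[OF assms(1) step.prems] .
  finally show ?case .
qed simp

lemma decrease_then_increase:
  assumes "\<not> markov_monotonic k b"
  shows "first_decrease_then_increase k b"
proof -
  \<comment> \<open>The critical slope is negative, so lines of nonnegative slope are
    increasing.\<close>
  have k: "k < 0"
  proof (rule ccontr)
    assume "\<not> k < 0"
    then have "- (alpha1 / beta1) \<le> k" using constants_pos by (smt (verit) divide_pos_pos)
    from increasing_if[OF this] assms show False by (simp add: markov_monotonic_def)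
  qed
  have ex: "\<exists>i. has_pt k b (Suc i) \<and> 1 \<le> ratio k b i"
    using assms unfolding markov_monotonic_def markov_decreasing_def by force
  define i0 where "i0 = (LEAST i. has_pt k b (Suc i) \<and> 1 \<le> ratio k b i)"
  have i0: "has_pt k b (Suc i0)" "1 \<le> ratio k b i0"
    using LeastI_ex[OF ex] by (simp_all add: i0_def)
  have "markov_at k b (Suc i) \<le> markov_at k b i" if "i < i0" for i
  proof -
    have h: "has_pt k b (Suc i)" using has_pt_less[OF i0(1)] that by simp
    then have "ratio k b i < 1" using not_less_Least[of i, folded i0_def] that
      unfolding i0_def by fastforce
    then show ?thesis using ratio_le_1[OF h] by (simp add: mtrace_at_markov)
  qed
  moreover have "markov_at k b i \<le> markov_at k b (Suc i)" if "i0 \<le> i" "has_pt k b (Suc i)" for i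
    using ratio_mono[OF k that] i0 ratio_ge_1[OF that(2)] by (simp add: mtrace_at_markov)
  moreover have "has_pt k b i0" using has_pt_less[OF i0(1)] by simp
  ultimately show ?thesis unfolding first_decrease_then_increase_def by blast
qed

lemma not_monotonic_iff:
  assumes "k < 0" "2 \<le> card (line_pts k b)"
  shows "\<not> markov_monotonic k b \<longleftrightarrow> first_ratio k b < 1 \<and> 1 < last_ratio k b"
proof
  \<comment> \<open>Indices start at 0, so n is the next-to-last index, the last one that has a
    ratio.\<close>
  define n where "n = card (line_pts k b) - 2"
  have "finite (line_pts k b)" using assms(2) by (intro card_ge_0_finite) simp
  then have has: "has_pt k b (Suc i) \<longleftrightarrow> i \<le> n" for i using assms(2) unfolding has_pt_def n_def by auto
  show "first_ratio k b < 1 \<and> 1 < last_ratio k b" if "\<not> markov_monotonic k b"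
  proof -
    have "\<exists>i\<le>n. ratio k b i < 1" "\<exists>j\<le>n. 1 < ratio k b j"
      using that by (auto simp: markov_monotonic_def markov_increasing_def markov_decreasing_def has not_le)
    then obtain i j where ij: "i \<le> n" "ratio k b i < 1" "j \<le> n" "1 < ratio k b j" by blast
    have "ratio k b 0 \<le> ratio k b i" "ratio k b j \<le> ratio k b n"
      using ratio_mono[OF assms(1)] ij has by simp_all
    with ij show ?thesis by (simp add: first_ratio_def last_ratio_def n_def)
  qed
  show "\<not> markov_monotonic k b" if "first_ratio k b < 1 \<and> 1 < last_ratio k b"
    using that has[of 0] has[of n]
    unfolding markov_monotonic_def markov_increasing_def markov_decreasing_def first_ratio_def last_ratio_def n_def
    by (auto simp: not_le)
qed

section \<open>Finitely many low lines, and non-monotonicity of high lines\<close>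

lemma finite_low_lines:
  assumes "k < 0"
  shows "finite {b. line_pts k b \<noteq> {} \<and> b \<le> B}"
proof -
  define N M where "N = nat \<lceil>B / (- k)\<rceil>" and "M = nat \<lceil>B\<rceil>"
  have "{b. line_pts k b \<noteq> {} \<and> b \<le> B} \<subseteq> (\<lambda>(x, y). real y - k * real x) ` ({..N} \<times> {..M})"
  proof
    fix b assume "b \<in> {b. line_pts k b \<noteq> {} \<and> b \<le> B}"
    then obtain x y where xy: "(x, y) \<in> line_pts k b" "b \<le> B" by auto
    note D = line_ptsD[OF xy(1)]
    \<comment> \<open>Both terms of b = y + (-k) x are nonnegative, so a low line has its points in
      a fixed finite box.\<close>
    have "0 \<le> - k * x" using assms by (simp add: mult_nonpos_nonneg)
    then have "real y \<le> B" "- k * x \<le> B" using D xy(2) by linarith+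
    then have "real y \<le> B" "real x \<le> B / (- k)" using assms by (simp_all add: field_simps)
    then have "y \<le> M" "x \<le> N" unfolding N_def M_def by linarith+
    moreover have "b = real y - k * real x" using D by simp
    ultimately show "b \<in> (\<lambda>(x, y). real y - k * real x) ` ({..N} \<times> {..M})" by force
  qed
  then show ?thesis by (rule finite_subset) simp
qed

lemma not_decreasing_high_line:
  assumes "- (alpha0 / beta0) < k" "k < 0"
  shows "\<exists>B. \<forall>b>B. line_pts k b \<noteq> {} \<longrightarrow> \<not> markov_decreasing k b"
proof -
  define s where "s = - p"
  have s: "0 < s" using assms(2) q_pos by (simp add: slope divide_less_0_iff s_def)
  have "0 < alpha0 * q + beta0 * p" using assms(1) q_pos constants_pos by (simp add: slope field_simps)
  from increase_near_axis[OF this, of "2 * s"] obtain B where B: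
    "\<And>x y. B \<le> x \<Longrightarrow> 0 < y \<Longrightarrow> y < x \<Longrightarrow> y \<le> 2 * s \<Longrightarrow> 0 < y + p \<Longrightarrow> y + p < x + q \<Longrightarrow>
      mtrace x y < mtrace (x + q) (y + p)" by blast
  \<comment> \<open>x > C ensures both x >= B and x > 2 s >= y.\<close>
  define C where "C = max B (2 * s + 1)"
  show ?thesis
  proof (intro exI[of _ "2 * s - k * C"] allI impI)
    fix b assume b: "2 * s - k * C < b" "line_pts k b \<noteq> {}"
    then obtain x0 y0 where xy0: "(x0, y0) \<in> line_pts k b" by auto
    note D = line_ptsD[OF xy0]
    \<comment> \<open>A residue in 1..s, raised by s, gives s < y <= 2 s: low enough for
      \<open>increase_near_axis\<close>, high enough that the next point stays above height 0. This
      is the last step on the line.\<close>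
    define m where "m = (int y0 - 1) div s - 1"
    define x y where "x = int x0 + m * q" and "y = int y0 + m * p"
    have "y = (int y0 - 1) mod s + 1 + s"
      unfolding y_def m_def s_def using mult_div_mod_eq[of "- p" "int y0 - 1"] by (simp add: algebra_simps)
    then have y: "s < y" "y \<le> 2 * s" using s by (simp_all add: add1_zle_eq)
    have line: "real_of_int y = k * x + b" using line_shift[of "int y0" m "int x0" b] D(3) by (simp add: x_def y_def)
    have "k * x < k * C"
    proof -
      have "real_of_int y \<le> 2 * real_of_int s" using y by linarith
      then show ?thesis using line b(1) by simp
    qed
    then have x: "C < x" using assms(2) by simp
    have xy: "0 < y" "y < x" "0 < y + p" "y + p < x + q" "B \<le> x"
      using x y s q_pos by (simp_all add: C_def s_def)
    from consecutive_pts[OF xy(1-4) line] obtain i where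
      i: "has_pt k b (Suc i)" "int (pt_x k b i) = x" "int (pt_y k b i) = y" .
    have "mtrace_at k b i < mtrace_at k b (Suc i)"
      unfolding mtrace_at_def pt_Suc[OF i(1)] i(2,3) using B xy y by simp
    then show "\<not> markov_decreasing k b"
      using ratio_le_1[OF i(1)] i(1) unfolding markov_decreasing_def by fastforce
  qed
qed

lemma not_increasing_high_line:
  assumes "k < - (alpha1 / beta1)"
  shows "\<exists>B. \<forall>b>B. line_pts k b \<noteq> {} \<longrightarrow> \<not> markov_increasing k b"
proof -
  have k: "k < 0" using assms constants_pos by (smt (verit) divide_pos_pos)
  have p: "p < 0" using k q_pos by (simp add: slope divide_less_0_iff)
  define s where "s = q - p"
  have s: "0 < s" using p q_pos by (simp add: s_def)
  have "alpha1 * q + beta1 * p < 0" using assms q_pos constants_pos by (simp add: slope field_simps)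
  from decrease_near_diag[OF this, of "2 * s"] obtain B where B:
    "\<And>x y. B \<le> y + p \<Longrightarrow> 0 < y \<Longrightarrow> y < x \<Longrightarrow> (x + q) - (y + p) \<le> 2 * s \<Longrightarrow> 0 < y + p \<Longrightarrow> y + p < x + q \<Longrightarrow>
      mtrace (x + q) (y + p) < mtrace x y" by blast
  \<comment> \<open>y > C makes the next height y + p exceed both B and 0.\<close>
  define C where "C = max B 1 - p"
  show ?thesis
  proof (intro exI[of _ "C - k * (C + s)"] allI impI)
    fix b assume b: "C - k * (C + s) < b" "line_pts k b \<noteq> {}"
    then obtain x0 y0 where xy0: "(x0, y0) \<in> line_pts k b" by auto
    note D = line_ptsD[OF xy0]
    \<comment> \<open>Reducing x - y to a residue in 1..s selects the first point of
      \<open>D\<close> on the line; one step adds s, so the next point has difference at most 2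
      s.\<close>
    define m where "m = - ((int x0 - int y0 - 1) div s)"
    define x y where "x = int x0 + m * q" and "y = int y0 + m * p"
    have "x - y = (int x0 - int y0 - 1) mod s + 1"
      unfolding x_def y_def m_def s_def using mult_div_mod_eq[of "q - p" "int x0 - int y0 - 1"]
      by (simp add: algebra_simps)
    then have d: "0 < x - y" "x - y \<le> s" using s by (simp_all add: add1_zle_eq)
    have line: "real_of_int y = k * x + b" using line_shift[of "int y0" m "int x0" b] D(3) by (simp add: x_def y_def)
    have y: "C < y"
    proof (rule ccontr)
      assume "\<not> C < y"
      then have "x \<le> C + s" using d by linarith
      then have "k * (C + s) \<le> k * x" using k by simp
      then show False using line b(1) \<open>\<not> C < y\<close> by simp
    qed
    have xy: "0 < y" "y < x" "0 < y + p" "y + p < x + q" "B \<le> y + p" "(x + q) - (y + p) \<le> 2 * s"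
      using d y s q_pos p by (simp_all add: C_def s_def)
    from consecutive_pts[OF xy(1-4) line] obtain i where
      i: "has_pt k b (Suc i)" "int (pt_x k b i) = x" "int (pt_y k b i) = y" .
    have "mtrace_at k b (Suc i) < mtrace_at k b i"
      unfolding mtrace_at_def pt_Suc[OF i(1)] i(2,3) using B xy by simp
    then show "\<not> markov_increasing k b"
      using ratio_ge_1[OF i(1)] i(1) unfolding markov_increasing_def by fastforce
  qed
qed

lemma finite_monotonic:
  assumes "- (alpha0 / beta0) < k" "k < - (alpha1 / beta1)"
  shows "finite {b \<in> \<rat>. line_pts k b \<noteq> {} \<and> markov_monotonic k b}"
proof -
  have k: "k < 0" using assms(2) constants_pos by (smt (verit) divide_pos_pos)
  obtain B B' where B: "\<forall>b>B. line_pts k b \<noteq> {} \<longrightarrow> \<not> markov_decreasing k b"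
    "\<forall>b>B'. line_pts k b \<noteq> {} \<longrightarrow> \<not> markov_increasing k b"
    using not_decreasing_high_line[OF assms(1) k] not_increasing_high_line[OF assms(2)] by blast
  have "{b \<in> \<rat>. line_pts k b \<noteq> {} \<and> markov_monotonic k b} \<subseteq> {b. line_pts k b \<noteq> {} \<and> b \<le> max B B'}"
  proof
    fix b assume b: "b \<in> {b \<in> \<rat>. line_pts k b \<noteq> {} \<and> markov_monotonic k b}"
    then have "\<not> (B < b \<and> B' < b)" using B by (auto simp: markov_monotonic_def)
    then show "b \<in> {b. line_pts k b \<noteq> {} \<and> b \<le> max B B'}" using b by auto
  qed
  then show ?thesis using finite_low_lines[OF k] finite_subset by blast
qed

end

lemma rational_slope_obtain:
  assumes "k \<in> \<rat>"
  obtains p q where "rational_slope k p q"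
  using assms
proof (cases rule: Rats_cases')
  case (1 a b)
  then show ?thesis using that[of a b] by (simp add: rational_slope_def)
qed

theorem theorem1p1:
  shows
    "(\<forall>k\<in>\<rat>. k \<ge> - (ln (3 * (2 + sqrt 2) / 4) / ln (2 * (2 + sqrt 2) / 3)) \<longrightarrow>
        (\<forall>b\<in>\<rat>. line_pts k b \<noteq> {} \<longrightarrow> markov_increasing k b)) \<and>
     (\<forall>k\<in>\<rat>. k \<le> - (2 * ln ((1 + sqrt 5) / 2) / ln (3 * (1 + sqrt 5) / (2 * sqrt 5))) \<longrightarrow>
        (\<forall>b\<in>\<rat>. line_pts k b \<noteq> {} \<longrightarrow> markov_decreasing k b)) \<and>
     (\<forall>k\<in>\<rat>. - (2 * ln ((1 + sqrt 5) / 2) / ln (3 * (1 + sqrt 5) / (2 * sqrt 5))) < k \<and>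
             k < - (ln (3 * (2 + sqrt 2) / 4) / ln (2 * (2 + sqrt 2) / 3)) \<longrightarrow>
        finite {b \<in> \<rat>. line_pts k b \<noteq> {} \<and> markov_monotonic k b}) \<and>
     (\<forall>k\<in>\<rat>. \<forall>b\<in>\<rat>. line_pts k b \<noteq> {} \<and> \<not> markov_monotonic k b \<longrightarrow>
        first_decrease_then_increase k b) \<and>
     (\<forall>k\<in>\<rat>. \<forall>b\<in>\<rat>. k < 0 \<and> card (line_pts k b) \<ge> 2 \<longrightarrow>
        (\<not> markov_monotonic k b \<longleftrightarrow> first_ratio k b < 1 \<and> last_ratio k b > 1))"
  unfolding alpha0_def[symmetric] beta0_def[symmetric] alpha1_def[symmetric] beta1_def[symmetric]
proof (intro conjI ballI impI)
  fix k :: real assume "k \<in> \<rat>"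
  then obtain p q where "rational_slope k p q" by (rule rational_slope_obtain)
  then interpret rational_slope k p q .
  show "markov_increasing k b" if "- (alpha1 / beta1) \<le> k" for b
    using that by (rule increasing_if)
  show "markov_decreasing k b" if "k \<le> - (alpha0 / beta0)" for b
    using that by (rule decreasing_if)
  show "finite {b \<in> \<rat>. line_pts k b \<noteq> {} \<and> markov_monotonic k b}"
    if "- (alpha0 / beta0) < k \<and> k < - (alpha1 / beta1)"
    using that finite_monotonic by blast
  show "first_decrease_then_increase k b" if "line_pts k b \<noteq> {} \<and> \<not> markov_monotonic k b" for b
    using that decrease_then_increase by blast
  fix b assume "k < 0 \<and> 2 \<le> card (line_pts k b)"
  then show "\<not> markov_monotonic k b \<longleftrightarrow> first_ratio k b < 1 \<and> 1 < last_ratio k b"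
    by (intro not_monotonic_iff) auto
qed

end
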